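(* Let $(M=M_1\times_{f_1}M_2,\Pi^{\nu_1},\tilde g^{f_1})$ be a contravariant warped product space. Then the qualar curvature of $M$ is a sum of sectional curvatures of planes spanned by null one-forms $\xi^i_s,\bar\xi^i_s\in\Gamma(T^*M)$ with $\tilde g^{f_1}(\xi^i_s,\bar\xi^i_s)=1$, and satisfies $$\mathcal Q(p)=2\sum_{i=1}^{q_1}\sum_{s=q_1+1}^{k_1}\mathcal K^M(\xi^{i,h}_{s,h},\bar\xi^{i,h}_{s,h})+2\sum_{i=1}^{q_1}\sum_{s=q_2+1}^{k_2}\mathcal K^M(\xi^{i,h}_{s,v},\bar\xi^{i,h}_{s,v})+2\sum_{i=1}^{q_2}\sum_{s=q_1+1}^{k_1}\mathcal K^M(\xi^{i,v}_{s,h},\bar\xi^{i,v}_{s,h})+2\sum_{i=1}^{q_2}\sum_{s=q_2+1}^{k_2}\mathcal K^M(\xi^{i,v}_{s,v},\bar\xi^{i,v}_{s,v}).$$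
   Context: Everything is smooth. For a bivector field $\Pi$ on a manifold $N$, the sharp map $\sharp_\Pi:T^*N\to TN$ is defined by $\eta(\sharp_\Pi(\omega))=\Pi(\omega,\eta)$, and the bracket on one-forms is $[\omega,\eta]_\Pi=\mathcal L_{\sharp_\Pi(\omega)}\eta-\mathcal L_{\sharp_\Pi(\eta)}\omega-d(\Pi(\omega,\eta))$. $(N,\Pi)$ is a Poisson manifold if the Schouten bracket $[\Pi,\Pi]_S$ vanishes. For a semi-Riemannian metric $\bar g$ on $N$, its cometric $\tilde g$ is the induced metric on $T^*N$. A contravariant connection $\mathcal D$ is an $\mathbb R$-bilinear map on one-forms with $\mathcal D_{f\omega}\eta=f\mathcal D_\omega\eta$ and $\mathcal D_\omega(f\eta)=f\mathcal D_\omega\eta+\sharp_\Pi(\omega)(f)\eta$. The contravariant Levi-Civita connection of $(\tilde g,\Pi)$ is the unique one satisfying $\mathcal D_\omega\eta-\mathcal D_\eta\omega=[\omega,\eta]_\Pi$ and $\sharp_\Pi(\omega)\tilde g(\eta,\gamma)=\tilde g(\mathcal D_\omega\eta,\gamma)+\tilde g(\eta,\mathcal D_\omega\gamma)$. Its curvature is $\mathcal R(\omega,\eta)\gamma=\mathcal D_\omega\mathcal D_\eta\gamma-\mathcal D_\eta\mathcal D_\omega\gamma-\mathcal D_{[\omega,\eta]_\Pi}\gamma$, and the sectional curvature is $$\mathcal K(\omega,\eta)=\frac{\tilde g(\mathcal R(\omega,\eta)\eta,\omega)}{\tilde g(\omega,\omega)\tilde g(\eta,\eta)-\tilde g(\omega,\eta)^2}.$$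 Contravariant warped product space: for $i=1,2$ let $(M_i,\Pi_i)$ be a Poisson manifold of dimension $k_i$ with semi-Riemannian metric $\bar g_i$ of index $q_i$ and cometric $\tilde g_i$. Let $f_1$ be a positive smooth function and $\nu_1$ a smooth function on $M_1$. Put $M=M_1\times M_2$ with projections $\pi_1,\pi_2$. The superscript $h$ denotes horizontal lift (pull-back by $\pi_1$) and $v$ denotes vertical lift (pull-back by $\pi_2$). $M$ carries the warped metric $\bar g^{f_1}=\pi_1^*\bar g_1+(f_1^h)^2\pi_2^*\bar g_2$, whose cometric is $\tilde g^{f_1}=\tilde g_1^h+\frac1{(f_1^h)^2}\tilde g_2^v$, and the bivector field $\Pi^{\nu_1}=\Pi_1+\nu_1\Pi_2$, i.e. $\Pi^{\nu_1}(\omega_1^h+\omega_2^v,\gamma_1^h+\gamma_2^v)=\Pi_1(\omega_1,\gamma_1)^h+\nu_1^h\Pi_2(\omega_2,\gamma_2)^v$. $\mathcal K^M$ is the sectional curvature of the contravariant Levi-Civita connection of $(\tilde g^{f_1},\Pi^{\nu_1})$. Frames: $\{dx_1,\dots,dx_{k_1}\}$ and $\{dy_1,\dots,dy_{k_2}\}$ are local orthonormal bases of one-forms for $\tilde g_1$ and $\tilde g_2$, the first $q_1$ (respectively $q_2$) having square norm $-1$ and the others $+1$, so that $\{dx_1^h,\dots,dx_{k_1}^h,f_1^hdy_1^v,\dots,f_1^hdy_{k_2}^v\}$ is a local $\tilde g^{f_1}$-orthonormal basis. The qualar curvature of $M$ at $p=(p_1,p_2)$ (with respect to these bases) is $$\mathcal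 Q(p)=2\sum_{i=1}^{q_1}\sum_{s=q_1+1}^{k_1}\mathcal K^M(dx_i^h,dx_s^h)+2\sum_{i=1}^{q_1}\sum_{s=q_2+1}^{k_2}\mathcal K^M(dx_i^h,f_1^hdy_s^v)+2\sum_{i=1}^{q_2}\sum_{s=q_1+1}^{k_1}\mathcal K^M(f_1^hdy_i^v,dx_s^h)+2\sum_{i=1}^{q_2}\sum_{s=q_2+1}^{k_2}\mathcal K^M(f_1^hdy_i^v,f_1^hdy_s^v).$$ The null one-forms are, in the corresponding index ranges, $$\xi^{i,h}_{s,h}=\tfrac1{\sqrt2}(dx_i^h+dx_s^h),\quad \xi^{i,h}_{s,v}=\tfrac1{\sqrt2}(dx_i^h+f_1^hdy_s^v),\quad \xi^{i,v}_{s,h}=\tfrac1{\sqrt2}(f_1^hdy_i^v+dx_s^h),\quad \xi^{i,v}_{s,v}=\tfrac1{\sqrt2}(f_1^hdy_i^v+f_1^hdy_s^v),$$ and the counterpart $\bar\xi$ of each is obtained by changing the sign of the first (timelike) summand: $$\bar\xi^{i,h}_{s,h}=\tfrac1{\sqrt2}(-dx_i^h+dx_s^h),\quad \bar\xi^{i,h}_{s,v}=\tfrac1{\sqrt2}(-dx_i^h+f_1^hdy_s^v),\quad \bar\xi^{i,v}_{s,h}=\tfrac1{\sqrt2}(-f_1^hdy_i^v+dx_s^h),\quad \bar\xi^{i,v}_{s,v}=\tfrac1{\sqrt2}(-f_1^hdy_i^v+f_1^hdy_s^v).$$ *)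

theory Defs
  imports "HOL-Analysis.Analysis"
begin

section \<open>Smooth maps between Euclidean spaces\<close>

text \<open>Only used for open sets \<open>S\<close>.\<close>

primrec Ck_on :: "nat \<Rightarrow> 'e::euclidean_space set \<Rightarrow> ('e \<Rightarrow> 'f::euclidean_space) \<Rightarrow> bool" where
  "Ck_on 0 S f \<longleftrightarrow> continuous_on S f"
| "Ck_on (Suc k) S f \<longleftrightarrow> (\<forall>x\<in>S. f differentiable (at x)) \<and>
     (\<forall>u. Ck_on k S (\<lambda>x. frechet_derivative f (at x) u))"

definition smooth_on :: "'e::euclidean_space set \<Rightarrow> ('e \<Rightarrow> 'f::euclidean_space) \<Rightarrow> bool" where
  "smooth_on S f \<longleftrightarrow> (\<forall>k. Ck_on k S f)"


section \<open>Smooth manifolds\<close>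

text \<open>
  A manifold is (the whole of) a second countable Hausdorff type \<open>'a\<close> with a smooth atlas
  modelled on \<open>'e\<close>; its dimension is \<open>DIM('e)\<close>. A chart is a pair of its domain and its
  coordinate map, the latter being relevant on the domain only. Atlases are not required
  to be maximal.
\<close>

type_synonym ('a, 'e) chart = "'a set \<times> ('a \<Rightarrow> 'e)"
type_synonym ('a, 'e) atlas = "('a, 'e) chart set"

definition chart_inv :: "('a, 'e) chart \<Rightarrow> 'e \<Rightarrow> 'a" where
  "chart_inv c = inv_into (fst c) (snd c)"

definition smooth_atlas ::
    "('a::{t2_space, second_countable_topology}, 'e::euclidean_space) atlas \<Rightarrow> bool" where
  "smooth_atlas A \<longleftrightarrow>
     (\<Union>c\<in>A. fst c) = UNIV \<and>
     (\<forall>c\<in>A. open (fst c) \<and> open (snd c ` fst c) \<and>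
        homeomorphism (fst c) (snd c ` fst c) (snd c) (chart_inv c)) \<and>
     (\<forall>c\<in>A. \<forall>d\<in>A. smooth_on (snd c ` (fst c \<inter> fst d)) (snd d \<circ> chart_inv c))"

definition prod_atlas :: "('a, 'e) atlas \<Rightarrow> ('b, 'f) atlas \<Rightarrow> ('a \<times> 'b, 'e \<times> 'f) atlas" where
  "prod_atlas A B = {(fst c \<times> fst d, map_prod (snd c) (snd d)) |c d. c \<in> A \<and> d \<in> B}"

text \<open>Smoothness of real functions on an open set \<open>W\<close>, and near a point.\<close>

definition smooth_fun ::
    "('a::topological_space, 'e::euclidean_space) atlas \<Rightarrow> 'a set \<Rightarrow> ('a \<Rightarrow> real) \<Rightarrow> bool" where
  "smooth_fun A W f \<longleftrightarrow> (\<forall>c\<in>A. smooth_on (snd c ` (fst c \<inter> W)) (f \<circ> chart_inv c))"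

definition smooth_at ::
    "('a::topological_space, 'e::euclidean_space) atlas \<Rightarrow> 'a \<Rightarrow> ('a \<Rightarrow> real) \<Rightarrow> bool" where
  "smooth_at A p f \<longleftrightarrow> (\<exists>W. open W \<and> p \<in> W \<and> smooth_fun A W f)"


section \<open>Tangent and cotangent vectors\<close>

text \<open>
  Tangent vectors at \<open>p\<close> are directional derivatives, acting on the functions that are smooth
  near \<open>p\<close> and extended by \<open>0\<close> to all other functions; covectors at \<open>p\<close> are the linear forms on
  the tangent space, again extended by \<open>0\<close>. With these conventions equality of (co)vectors is
  equality of HOL functions.
\<close>

type_synonym 'a tvec = "('a \<Rightarrow> real) \<Rightarrow> real"
type_synonym 'a covec = "'a tvec \<Rightarrow> real"
type_synonym 'a vfield = "'a \<Rightarrow> 'a tvec"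
type_synonym 'a form = "'a \<Rightarrow> 'a covec"
type_synonym 'a tmetric = "'a \<Rightarrow> 'a tvec \<Rightarrow> 'a tvec \<Rightarrow> real"
type_synonym 'a cotensor = "'a \<Rightarrow> 'a covec \<Rightarrow> 'a covec \<Rightarrow> real"

definition coord_vec ::
    "('a::topological_space, 'e::euclidean_space) atlas \<Rightarrow> ('a, 'e) chart \<Rightarrow> 'e \<Rightarrow> 'a vfield" where
  "coord_vec A c u p =
     (\<lambda>f. if smooth_at A p f then frechet_derivative (f \<circ> chart_inv c) (at (snd c p)) u else 0)"

definition tangent_space ::
    "('a::topological_space, 'e::euclidean_space) atlas \<Rightarrow> 'a \<Rightarrow> 'a tvec set" where
  "tangent_space A p = {coord_vec A c u p |c u. c \<in> A \<and> p \<in> fst c}"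

definition linear_form_on :: "('x \<Rightarrow> real) set \<Rightarrow> (('x \<Rightarrow> real) \<Rightarrow> real) \<Rightarrow> bool" where
  "linear_form_on S \<beta> \<longleftrightarrow>
     (\<forall>v\<in>S. \<forall>w\<in>S. \<beta> (\<lambda>x. v x + w x) = \<beta> v + \<beta> w) \<and>
     (\<forall>v\<in>S. \<forall>r. \<beta> (\<lambda>x. r * v x) = r * \<beta> v)"

definition bilinear_form_on ::
    "('x \<Rightarrow> real) set \<Rightarrow> (('x \<Rightarrow> real) \<Rightarrow> ('x \<Rightarrow> real) \<Rightarrow> real) \<Rightarrow> bool" where
  "bilinear_form_on S b \<longleftrightarrow>
     (\<forall>v\<in>S. linear_form_on S (b v)) \<and> (\<forall>w\<in>S. linear_form_on S (\<lambda>v. b v w))"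

definition cotangent_space ::
    "('a::topological_space, 'e::euclidean_space) atlas \<Rightarrow> 'a \<Rightarrow> 'a covec set" where
  "cotangent_space A p =
     {\<beta>. linear_form_on (tangent_space A p) \<beta> \<and> (\<forall>v. v \<notin> tangent_space A p \<longrightarrow> \<beta> v = 0)}"

definition differential ::
    "('a::topological_space, 'e::euclidean_space) atlas \<Rightarrow> ('a \<Rightarrow> real) \<Rightarrow> 'a form" where
  "differential A f p = (\<lambda>v. if v \<in> tangent_space A p then v f else 0)"

definition pushforward ::
    "('b::topological_space, 'f::euclidean_space) atlas \<Rightarrow> ('a \<Rightarrow> 'b) \<Rightarrow> 'a \<Rightarrow> 'a tvec \<Rightarrow> 'b tvec" where
  "pushforward B F p v = (\<lambda>f. if smooth_at B (F p) f then v (f \<circ> F) else 0)"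

definition pullback_covec ::
    "('a::topological_space, 'e::euclidean_space) atlas \<Rightarrow> ('b::topological_space, 'f::euclidean_space) atlas
      \<Rightarrow> ('a \<Rightarrow> 'b) \<Rightarrow> 'a \<Rightarrow> 'b covec \<Rightarrow> 'a covec" where
  "pullback_covec A B F p \<beta> =
     (\<lambda>v. if v \<in> tangent_space A p then \<beta> (pushforward B F p v) else 0)"


section \<open>Vector fields and one-forms\<close>

text \<open>
  Local sections over an open set \<open>W\<close> are total functions of which only the values on \<open>W\<close> matter;
  \<open>W = UNIV\<close> gives global sections.
\<close>

definition vector_field ::
    "('a::topological_space, 'e::euclidean_space) atlas \<Rightarrow> 'a set \<Rightarrow> 'a vfield \<Rightarrow> bool" where
  "vector_field A W X \<longleftrightarrow>
     (\<forall>p\<in>W. X p \<in> tangent_space A p) \<and>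
     (\<forall>V f. open V \<and> V \<subseteq> W \<and> smooth_fun A V f \<longrightarrow> smooth_fun A V (\<lambda>p. X p f))"

definition one_form ::
    "('a::topological_space, 'e::euclidean_space) atlas \<Rightarrow> 'a set \<Rightarrow> 'a form \<Rightarrow> bool" where
  "one_form A W \<omega> \<longleftrightarrow>
     (\<forall>p\<in>W. \<omega> p \<in> cotangent_space A p) \<and>
     (\<forall>c\<in>A. \<forall>u. smooth_fun A (W \<inter> fst c) (\<lambda>p. \<omega> p (coord_vec A c u p)))"

definition form_add :: "'a form \<Rightarrow> 'a form \<Rightarrow> 'a form" where
  "form_add \<omega> \<eta> = (\<lambda>p v. \<omega> p v + \<eta> p v)"

definition form_diff :: "'a form \<Rightarrow> 'a form \<Rightarrow> 'a form" where
  "form_diff \<omega> \<eta> = (\<lambda>p v. \<omega> p v - \<eta> p v)"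

definition form_mult :: "('a \<Rightarrow> real) \<Rightarrow> 'a form \<Rightarrow> 'a form" where
  "form_mult f \<omega> = (\<lambda>p v. f p * \<omega> p v)"

definition lie_bracket ::
    "('a::topological_space, 'e::euclidean_space) atlas \<Rightarrow> 'a vfield \<Rightarrow> 'a vfield \<Rightarrow> 'a vfield" where
  "lie_bracket A X Y p =
     (\<lambda>f. if smooth_at A p f then X p (\<lambda>q. Y q f) - Y p (\<lambda>q. X q f) else 0)"

text \<open>
  The Lie derivative of a one-form, \<open>(L\<^sub>X \<eta>)(Y) = X (\<eta> Y) - \<eta> [X, Y]\<close>. To evaluate it on a single
  tangent vector \<open>v\<close> at \<open>p\<close>, \<open>Y\<close> is any vector field near \<open>p\<close> with value \<open>v\<close> at \<open>p\<close>; the result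
  does not depend on the choice, since the right-hand side is tensorial in \<open>Y\<close>.
\<close>

definition lie_derivative ::
    "('a::topological_space, 'e::euclidean_space) atlas \<Rightarrow> 'a vfield \<Rightarrow> 'a form \<Rightarrow> 'a form" where
  "lie_derivative A X \<eta> p =
     (\<lambda>v. if v \<in> tangent_space A p then
            (let Y = (SOME Y. \<exists>W. open W \<and> p \<in> W \<and> vector_field A W Y \<and> Y p = v)
             in X p (\<lambda>q. \<eta> q (Y q)) - \<eta> p (lie_bracket A X Y p))
          else 0)"


section \<open>Semi-Riemannian metrics\<close>

text \<open>The index of a symmetric bilinear form: the largest dimension of a subspace on which it
  is negative definite.\<close>

definition form_index :: "('e::euclidean_space \<Rightarrow> 'e \<Rightarrow> real) \<Rightarrow> nat" where
  "form_index b = Max {dim S |S. subspace S \<and> (\<forall>u\<in>S. u \<noteq> 0 \<longrightarrow> b u u < 0)}"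

definition semi_riemannian_metric ::
    "('a::topological_space, 'e::euclidean_space) atlas \<Rightarrow> nat \<Rightarrow> 'a tmetric \<Rightarrow> bool" where
  "semi_riemannian_metric A q g \<longleftrightarrow>
     (\<forall>p. bilinear_form_on (tangent_space A p) (g p) \<and>
          (\<forall>v\<in>tangent_space A p. \<forall>w\<in>tangent_space A p. g p v w = g p w v) \<and>
          (\<forall>v\<in>tangent_space A p. (\<forall>w\<in>tangent_space A p. g p v w = 0) \<longrightarrow> v = (\<lambda>_. 0))) \<and>
     (\<forall>c\<in>A. \<forall>u w. smooth_fun A (fst c) (\<lambda>p. g p (coord_vec A c u p) (coord_vec A c w p))) \<and>
     (\<forall>c\<in>A. \<forall>p\<in>fst c. form_index (\<lambda>u w. g p (coord_vec A c u p) (coord_vec A c w p)) = q)"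

definition metric_sharp ::
    "('a::topological_space, 'e::euclidean_space) atlas \<Rightarrow> 'a tmetric \<Rightarrow> 'a \<Rightarrow> 'a covec \<Rightarrow> 'a tvec" where
  "metric_sharp A g p \<alpha> =
     (THE v. v \<in> tangent_space A p \<and> (\<forall>w\<in>tangent_space A p. g p v w = \<alpha> w))"

definition cometric ::
    "('a::topological_space, 'e::euclidean_space) atlas \<Rightarrow> 'a tmetric \<Rightarrow> 'a cotensor" where
  "cometric A g p \<alpha> \<beta> = g p (metric_sharp A g p \<alpha>) (metric_sharp A g p \<beta>)"

text \<open>Since there are \<open>DIM('e)\<close> of them, orthonormal one-forms form a basis at each point.\<close>

definition orthonormal_coframe ::
    "('a::topological_space, 'e::euclidean_space) atlas \<Rightarrow> 'a cotensor \<Rightarrow> nat \<Rightarrow> 'a set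
      \<Rightarrow> (nat \<Rightarrow> 'a form) \<Rightarrow> bool" where
  "orthonormal_coframe A gt q U e \<longleftrightarrow>
     (\<forall>i\<in>{1..DIM('e)}. one_form A U (e i)) \<and>
     (\<forall>p\<in>U. \<forall>i\<in>{1..DIM('e)}. \<forall>j\<in>{1..DIM('e)}.
        gt p (e i p) (e j p) = (if i = j then (if i \<le> q then - 1 else 1) else 0))"


section \<open>Poisson manifolds\<close>

definition bivector_field ::
    "('a::topological_space, 'e::euclidean_space) atlas \<Rightarrow> 'a cotensor \<Rightarrow> bool" where
  "bivector_field A P \<longleftrightarrow>
     (\<forall>p. bilinear_form_on (cotangent_space A p) (P p) \<and>
          (\<forall>\<alpha>\<in>cotangent_space A p. \<forall>\<beta>\<in>cotangent_space A p. P p \<alpha> \<beta> = - P p \<beta> \<alpha>)) \<and>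
     (\<forall>V f h. open V \<and> smooth_fun A V f \<and> smooth_fun A V h \<longrightarrow>
        smooth_fun A V (\<lambda>p. P p (differential A f p) (differential A h p)))"

definition sharp ::
    "('a::topological_space, 'e::euclidean_space) atlas \<Rightarrow> 'a cotensor \<Rightarrow> 'a form \<Rightarrow> 'a vfield" where
  "sharp A P \<omega> p =
     (THE v. v \<in> tangent_space A p \<and> (\<forall>\<eta>\<in>cotangent_space A p. \<eta> v = P p (\<omega> p) \<eta>))"

text \<open>
  The Schouten bracket of multivector fields \<open>P\<close>, \<open>Q\<close> of degrees \<open>a\<close>, \<open>b\<close>, regarded as
  multiderivations of the algebra of smooth functions, is
  \<open>P \<circ> Q - (-1)^((a-1)(b-1)) Q \<circ> P\<close>, where \<open>(P \<circ> Q)(f\<^sub>1, ...)\<close> is the signed sum over all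
  \<open>(b, a-1)\<close>-shuffles of \<open>P (Q (f\<^sub>1, ..., f\<^sub>b), ...)\<close>. Here \<open>a = b = 2\<close>.
\<close>

definition biderivation ::
    "('a::topological_space, 'e::euclidean_space) atlas \<Rightarrow> 'a cotensor
      \<Rightarrow> ('a \<Rightarrow> real) \<Rightarrow> ('a \<Rightarrow> real) \<Rightarrow> 'a \<Rightarrow> real" where
  "biderivation A P f h = (\<lambda>p. P p (differential A f p) (differential A h p))"

definition bider_comp ::
    "('a::topological_space, 'e::euclidean_space) atlas \<Rightarrow> 'a cotensor \<Rightarrow> 'a cotensor
      \<Rightarrow> ('a \<Rightarrow> real) \<Rightarrow> ('a \<Rightarrow> real) \<Rightarrow> ('a \<Rightarrow> real) \<Rightarrow> 'a \<Rightarrow> real" where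
  "bider_comp A P Q f h k = (\<lambda>p.
       biderivation A P (biderivation A Q f h) k p
     - biderivation A P (biderivation A Q f k) h p
     + biderivation A P (biderivation A Q h k) f p)"

definition schouten_bracket ::
    "('a::topological_space, 'e::euclidean_space) atlas \<Rightarrow> 'a cotensor \<Rightarrow> 'a cotensor
      \<Rightarrow> ('a \<Rightarrow> real) \<Rightarrow> ('a \<Rightarrow> real) \<Rightarrow> ('a \<Rightarrow> real) \<Rightarrow> 'a \<Rightarrow> real" where
  "schouten_bracket A P Q f h k = (\<lambda>p. bider_comp A P Q f h k p + bider_comp A Q P f h k p)"

definition poisson ::
    "('a::topological_space, 'e::euclidean_space) atlas \<Rightarrow> 'a cotensor \<Rightarrow> bool" where
  "poisson A P \<longleftrightarrow> bivector_field A P \<and>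
     (\<forall>p f h k. smooth_at A p f \<and> smooth_at A p h \<and> smooth_at A p k \<longrightarrow>
        schouten_bracket A P P f h k p = 0)"

definition form_bracket ::
    "('a::topological_space, 'e::euclidean_space) atlas \<Rightarrow> 'a cotensor \<Rightarrow> 'a form \<Rightarrow> 'a form \<Rightarrow> 'a form" where
  "form_bracket A P \<omega> \<eta> =
     form_diff (form_diff (lie_derivative A (sharp A P \<omega>) \<eta>) (lie_derivative A (sharp A P \<eta>) \<omega>))
               (differential A (\<lambda>p. P p (\<omega> p) (\<eta> p)))"


section \<open>Contravariant connections and their curvature\<close>

text \<open>
  A connection is needed on local one-forms, too, because orthonormal coframes exist only
  locally. So the axioms are imposed over every open set \<open>W\<close>; they imply that \<open>D\<close> is local, i.e.
  that \<open>D \<omega> \<eta>\<close> on \<open>W\<close> depends only on \<open>\<omega>\<close> and \<open>\<eta>\<close> on \<open>W\<close>. The case \<open>W = UNIV\<close> is that of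
  global one-forms; a connection on these extends uniquely to local one-forms.
\<close>

definition contravariant_connection ::
    "('a::topological_space, 'e::euclidean_space) atlas \<Rightarrow> 'a cotensor
      \<Rightarrow> ('a form \<Rightarrow> 'a form \<Rightarrow> 'a form) \<Rightarrow> bool" where
  "contravariant_connection A P D \<longleftrightarrow> (\<forall>W. open W \<longrightarrow>
     (\<forall>\<omega> \<eta>. one_form A W \<omega> \<and> one_form A W \<eta> \<longrightarrow> one_form A W (D \<omega> \<eta>)) \<and>
     (\<forall>\<omega> \<eta> \<gamma>. one_form A W \<omega> \<and> one_form A W \<eta> \<and> one_form A W \<gamma> \<longrightarrow> (\<forall>p\<in>W.
        D (form_add \<omega> \<eta>) \<gamma> p = form_add (D \<omega> \<gamma>) (D \<eta> \<gamma>) p \<and>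
        D \<omega> (form_add \<eta> \<gamma>) p = form_add (D \<omega> \<eta>) (D \<omega> \<gamma>) p)) \<and>
     (\<forall>\<omega> \<eta>. \<forall>r::real. one_form A W \<omega> \<and> one_form A W \<eta> \<longrightarrow> (\<forall>p\<in>W.
        D (form_mult (\<lambda>_. r) \<omega>) \<eta> p = form_mult (\<lambda>_. r) (D \<omega> \<eta>) p \<and>
        D \<omega> (form_mult (\<lambda>_. r) \<eta>) p = form_mult (\<lambda>_. r) (D \<omega> \<eta>) p)) \<and>
     (\<forall>\<omega> \<eta> f. one_form A W \<omega> \<and> one_form A W \<eta> \<and> smooth_fun A W f \<longrightarrow> (\<forall>p\<in>W.
        D (form_mult f \<omega>) \<eta> p = form_mult f (D \<omega> \<eta>) p \<and>
        D \<omega> (form_mult f \<eta>) p =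
          form_add (form_mult f (D \<omega> \<eta>)) (form_mult (\<lambda>x. sharp A P \<omega> x f) \<eta>) p)))"

definition levi_civita ::
    "('a::topological_space, 'e::euclidean_space) atlas \<Rightarrow> 'a cotensor \<Rightarrow> 'a cotensor
      \<Rightarrow> ('a form \<Rightarrow> 'a form \<Rightarrow> 'a form) \<Rightarrow> bool" where
  "levi_civita A gt P D \<longleftrightarrow> contravariant_connection A P D \<and> (\<forall>W. open W \<longrightarrow>
     (\<forall>\<omega> \<eta>. one_form A W \<omega> \<and> one_form A W \<eta> \<longrightarrow> (\<forall>p\<in>W.
        form_diff (D \<omega> \<eta>) (D \<eta> \<omega>) p = form_bracket A P \<omega> \<eta> p)) \<and>
     (\<forall>\<omega> \<eta> \<gamma>. one_form A W \<omega> \<and> one_form A W \<eta> \<and> one_form A W \<gamma> \<longrightarrow> (\<forall>p\<in>W.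
        sharp A P \<omega> p (\<lambda>x. gt x (\<eta> x) (\<gamma> x)) =
          gt p (D \<omega> \<eta> p) (\<gamma> p) + gt p (\<eta> p) (D \<omega> \<gamma> p))))"

definition curvature ::
    "('a::topological_space, 'e::euclidean_space) atlas \<Rightarrow> 'a cotensor
      \<Rightarrow> ('a form \<Rightarrow> 'a form \<Rightarrow> 'a form) \<Rightarrow> 'a form \<Rightarrow> 'a form \<Rightarrow> 'a form \<Rightarrow> 'a form" where
  "curvature A P D \<omega> \<eta> \<gamma> =
     form_diff (form_diff (D \<omega> (D \<eta> \<gamma>)) (D \<eta> (D \<omega> \<gamma>))) (D (form_bracket A P \<omega> \<eta>) \<gamma>)"

definition sectional_curvature ::
    "('a::topological_space, 'e::euclidean_space) atlas \<Rightarrow> 'a cotensor \<Rightarrow> 'a cotensor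
      \<Rightarrow> ('a form \<Rightarrow> 'a form \<Rightarrow> 'a form) \<Rightarrow> 'a form \<Rightarrow> 'a form \<Rightarrow> 'a \<Rightarrow> real" where
  "sectional_curvature A gt P D \<omega> \<eta> p =
     gt p (curvature A P D \<omega> \<eta> \<eta> p) (\<omega> p) /
     (gt p (\<omega> p) (\<omega> p) * gt p (\<eta> p) (\<eta> p) - (gt p (\<omega> p) (\<eta> p))\<^sup>2)"


section \<open>Contravariant warped products\<close>

definition hlift ::
    "('a::topological_space, 'e::euclidean_space) atlas \<Rightarrow> ('b::topological_space, 'f::euclidean_space) atlas
      \<Rightarrow> 'a form \<Rightarrow> ('a \<times> 'b) form" where
  "hlift A B \<omega> p = pullback_covec (prod_atlas A B) A fst p (\<omega> (fst p))"

definition vlift ::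
    "('a::topological_space, 'e::euclidean_space) atlas \<Rightarrow> ('b::topological_space, 'f::euclidean_space) atlas
      \<Rightarrow> 'b form \<Rightarrow> ('a \<times> 'b) form" where
  "vlift A B \<omega> p = pullback_covec (prod_atlas A B) B snd p (\<omega> (snd p))"

definition warped_metric ::
    "('a::topological_space, 'e::euclidean_space) atlas \<Rightarrow> ('b::topological_space, 'f::euclidean_space) atlas
      \<Rightarrow> 'a tmetric \<Rightarrow> ('a \<Rightarrow> real) \<Rightarrow> 'b tmetric \<Rightarrow> ('a \<times> 'b) tmetric" where
  "warped_metric A B g1 f g2 p v w =
     g1 (fst p) (pushforward A fst p v) (pushforward A fst p w) +
     (f (fst p))\<^sup>2 * g2 (snd p) (pushforward B snd p v) (pushforward B snd p w)"

text \<open>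
  The covector \<open>\<omega>\<^sub>1\<^sup>h + \<omega>\<^sub>2\<^sup>v\<close> at \<open>(x, y)\<close> has the components \<open>\<omega>\<^sub>1\<close> and \<open>\<omega>\<^sub>2\<close>, which are recovered as
  its pull-backs along the inclusions of the slices \<open>M\<^sub>1 \<times> {y}\<close> and \<open>{x} \<times> M\<^sub>2\<close>.
\<close>

definition hpart ::
    "('a::topological_space, 'e::euclidean_space) atlas \<Rightarrow> ('b::topological_space, 'f::euclidean_space) atlas
      \<Rightarrow> 'a \<times> 'b \<Rightarrow> ('a \<times> 'b) covec \<Rightarrow> 'a covec" where
  "hpart A B p = pullback_covec A (prod_atlas A B) (\<lambda>x. (x, snd p)) (fst p)"

definition vpart ::
    "('a::topological_space, 'e::euclidean_space) atlas \<Rightarrow> ('b::topological_space, 'f::euclidean_space) atlas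
      \<Rightarrow> 'a \<times> 'b \<Rightarrow> ('a \<times> 'b) covec \<Rightarrow> 'b covec" where
  "vpart A B p = pullback_covec B (prod_atlas A B) (\<lambda>y. (fst p, y)) (snd p)"

definition warped_bivector ::
    "('a::topological_space, 'e::euclidean_space) atlas \<Rightarrow> ('b::topological_space, 'f::euclidean_space) atlas
      \<Rightarrow> 'a cotensor \<Rightarrow> ('a \<Rightarrow> real) \<Rightarrow> 'b cotensor \<Rightarrow> ('a \<times> 'b) cotensor" where
  "warped_bivector A B P1 \<nu> P2 p \<alpha> \<beta> =
     P1 (fst p) (hpart A B p \<alpha>) (hpart A B p \<beta>) +
     \<nu> (fst p) * P2 (snd p) (vpart A B p \<alpha>) (vpart A B p \<beta>)"


section \<open>Qualar curvature and null one-forms\<close>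

text \<open>Here \<open>a\<close> and \<open>b\<close> are the horizontal and the vertical part of the coframe.\<close>

definition qualar_curvature ::
    "('m form \<Rightarrow> 'm form \<Rightarrow> 'm \<Rightarrow> real) \<Rightarrow> nat \<Rightarrow> nat \<Rightarrow> nat \<Rightarrow> nat
      \<Rightarrow> (nat \<Rightarrow> 'm form) \<Rightarrow> (nat \<Rightarrow> 'm form) \<Rightarrow> 'm \<Rightarrow> real" where
  "qualar_curvature K q1 k1 q2 k2 a b p =
     2 * (\<Sum>i=1..q1. \<Sum>s=q1+1..k1. K (a i) (a s) p) +
     2 * (\<Sum>i=1..q1. \<Sum>s=q2+1..k2. K (a i) (b s) p) +
     2 * (\<Sum>i=1..q2. \<Sum>s=q1+1..k1. K (b i) (a s) p) +
     2 * (\<Sum>i=1..q2. \<Sum>s=q2+1..k2. K (b i) (b s) p)"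

definition null_form :: "'a form \<Rightarrow> 'a form \<Rightarrow> 'a form" where
  "null_form \<tau> \<sigma> = form_mult (\<lambda>_. 1 / sqrt 2) (form_add \<tau> \<sigma>)"

definition null_form_bar :: "'a form \<Rightarrow> 'a form \<Rightarrow> 'a form" where
  "null_form_bar \<tau> \<sigma> = form_mult (\<lambda>_. 1 / sqrt 2) (form_add (form_mult (\<lambda>_. - 1) \<tau>) \<sigma>)"

text \<open>The last condition says that the two one-forms span a plane at every point; in particular
  they vanish nowhere.\<close>

definition null_pair ::
    "('a::topological_space, 'e::euclidean_space) atlas \<Rightarrow> 'a cotensor \<Rightarrow> 'a set \<Rightarrow> 'a form \<Rightarrow> 'a form \<Rightarrow> bool" where
  "null_pair A gt W \<xi> \<xi>' \<longleftrightarrow>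
     one_form A W \<xi> \<and> one_form A W \<xi>' \<and>
     (\<forall>p\<in>W. gt p (\<xi> p) (\<xi> p) = 0 \<and> gt p (\<xi>' p) (\<xi>' p) = 0 \<and> gt p (\<xi> p) (\<xi>' p) = 1 \<and>
        (\<forall>r s. (\<forall>v. r * \<xi> p v + s * \<xi>' p v = 0) \<longrightarrow> r = 0 \<and> s = 0))"

end

theory Submission
  imports Defs
begin

text \<open>
  A null pair \<open>\<xi>, \<xi>'\<close> built from a timelike \<open>\<tau>\<close> and a spacelike \<open>\<sigma>\<close> of an orthonormal coframe spans the
  same plane as \<open>\<tau>\<close> and \<open>\<sigma>\<close>, so the formula for the qualar curvature holds summand by summand, once the
  sectional curvature is known to depend on the plane only. Write \<open>\<omega> = a \<tau> + b \<sigma>\<close> and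
  \<open>\<eta> = c \<tau> + d \<sigma>\<close>. Since \<open>R\<close> is bilinear and antisymmetric in its first two arguments,
  \<open>R(\<omega>, \<eta>) = (a d - b c) R(\<tau>, \<sigma>)\<close>; the second factor \<open>a d - b c\<close>, which the Gram determinant in the
  denominator requires, appears if \<open>R(\<tau>, \<sigma>)\<close> is skew-adjoint on the plane.

  The usual reason for this skewness is \<open>\<sharp>[\<omega>, \<eta>] = [\<sharp>\<omega>, \<sharp>\<eta>]\<close>, which holds for Poisson bivector
  fields. But \<open>\<Pi>\<^sub>1 + \<nu> \<Pi>\<^sub>2\<close> need not be one: its Schouten bracket contains \<open>\<sharp>\<^sub>1(d\<nu>) \<and> \<Pi>\<^sub>2\<close>. Metricity
  alone gives that \<open>g(R(\<omega>, \<eta>) \<gamma>, \<delta>) + g(\<gamma>, R(\<omega>, \<eta>) \<delta>)\<close> equals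
  \<open>([\<sharp>\<omega>, \<sharp>\<eta>] - \<sharp>[\<omega>, \<eta>])\<close> applied to the function \<open>g(\<gamma>, \<delta>)\<close>. For members of an orthonormal coframe
  that function is constant, and skewness follows (\<open>curvature_skew_metric\<close>,
  \<open>sectional_curvature_change_basis\<close>).

  It remains to see that \<open>dx\<^sub>i\<^sup>h\<close> and \<open>f\<^sub>1 dy\<^sub>s\<^sup>v\<close> are smooth one-forms on the product, orthonormal for the
  warped cometric. The tangent space of the product is the direct sum of those of the factors, and
  the vectors dual to these one-forms can be written down: the one dual to \<open>\<alpha>\<^sup>h\<close> is horizontal, and the
  one dual to \<open>f\<^sub>1 \<beta>\<^sup>v\<close> is vertical with a factor \<open>1 / f\<^sub>1\<close> (\<open>metric_sharp_hlift\<close>,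
  \<open>metric_sharp_vlift\<close>).
\<close>


section \<open>Calculus of \<open>C\<^sup>k\<close> maps\<close>

lemma Ck_on_cong:
  assumes "open S" "\<And>x. x \<in> S \<Longrightarrow> f x = g x" "Ck_on k S f"
  shows "Ck_on k S g"
  using assms(2,3)
proof (induction k arbitrary: f g)
  case 0
  then show ?case by (simp cong: continuous_on_cong)
next
  case (Suc k)
  have diff: "g differentiable at x"
    and deriv: "frechet_derivative f (at x) = frechet_derivative g (at x)" if "x \<in> S" for x
  proof -
    have "f differentiable at x" using Suc.prems that by simp
    then show "frechet_derivative f (at x) = frechet_derivative g (at x)"
      using frechet_derivative_transform_within_open assms(1) that Suc.prems(1) by blast
    show "g differentiable at x"
      using \<open>f differentiable at x\<close> assms(1) that Suc.prems(1)
      unfolding differentiable_def by (meson has_derivative_transform_within_open)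
  qed
  have "Ck_on k S (\<lambda>x. frechet_derivative g (at x) u)" for u
    by (rule Suc.IH[of "\<lambda>x. frechet_derivative f (at x) u"]) (use deriv Suc.prems in auto)
  then show ?case using diff by simp
qed

lemma frechet_derivative_eqI:
  "(f has_derivative f') (at x) \<Longrightarrow> frechet_derivative f (at x) = f'"
  using frechet_derivative_at by fastforce

text \<open>
  It suffices to control any formula for the derivative: on an open set it agrees with the
  \<open>frechet_derivative\<close> in the definition of \<open>Ck_on\<close>.
\<close>

lemma Ck_on_SucI:
  assumes "open S"
    and "\<And>x. x \<in> S \<Longrightarrow> (f has_derivative f' x) (at x)"
    and "\<And>u. Ck_on k S (\<lambda>x. f' x u)"
  shows "Ck_on (Suc k) S f"
proof -
  have "Ck_on k S (\<lambda>x. frechet_derivative f (at x) u)" for u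
    by (rule Ck_on_cong[OF assms(1) _ assms(3)[of u]])
      (simp add: frechet_derivative_eqI[OF assms(2)])
  then show ?thesis using assms(2) by (auto simp: differentiable_def)
qed

lemma Ck_on_SucD:
  assumes "Ck_on (Suc k) S f"
  shows "x \<in> S \<Longrightarrow> (f has_derivative frechet_derivative f (at x)) (at x)"
    and "Ck_on k S (\<lambda>x. frechet_derivative f (at x) u)"
  using assms by (auto simp: frechet_derivative_works)

lemma Ck_on_Suc_imp_Ck_on: "Ck_on (Suc k) S f \<Longrightarrow> Ck_on k S f"
proof (induction k arbitrary: f)
  case 0
  then show ?case
    by (auto intro!: continuous_at_imp_continuous_on differentiable_imp_continuous_within)
next
  case (Suc k)
  then show ?case by (metis Ck_on.simps(2))
qed

lemma Ck_on_subset: "Ck_on k S f \<Longrightarrow> T \<subseteq> S \<Longrightarrow> Ck_on k T f"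
proof (induction k arbitrary: f)
  case 0
  then show ?case using continuous_on_subset by auto
next
  case (Suc k)
  then show ?case by (simp add: subset_iff)
qed

lemma Ck_on_const: "open S \<Longrightarrow> Ck_on k S (\<lambda>_. c)"
proof (induction k arbitrary: c)
  case (Suc k)
  then show ?case by (intro Ck_on_SucI[where f' = "\<lambda>_ _. 0"]) auto
qed simp

lemma Ck_on_bounded_linear:
  assumes "open S" "bounded_linear h" "Ck_on k S f"
  shows "Ck_on k S (\<lambda>x. h (f x))"
  using assms(3)
proof (induction k arbitrary: f)
  case 0
  then show ?case using assms(2) by (simp add: bounded_linear.continuous_on)
next
  case (Suc k)
  show ?case
  proof (rule Ck_on_SucI[OF assms(1), where f' = "\<lambda>x u. h (frechet_derivative f (at x) u)"])
    show "((\<lambda>x. h (f x)) has_derivative (\<lambda>u. h (frechet_derivative f (at x) u))) (at x)"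
      if "x \<in> S" for x
      by (rule bounded_linear.has_derivative[OF assms(2) Ck_on_SucD(1)[OF Suc.prems that]])
    show "Ck_on k S (\<lambda>x. h (frechet_derivative f (at x) u))" for u
      by (rule Suc.IH[OF Ck_on_SucD(2)[OF Suc.prems]])
  qed
qed

lemma Ck_on_compose_linear:
  assumes "open T" "bounded_linear h" "h ` T \<subseteq> S" "Ck_on k S f"
  shows "Ck_on k T (\<lambda>x. f (h x))"
  using assms(4)
proof (induction k arbitrary: f)
  case 0
  then show ?case
    using assms(2,3)
    by (auto intro!: continuous_on_compose2[of S f T h] bounded_linear.continuous_on[OF assms(2)])
next
  case (Suc k)
  show ?case
  proof (rule Ck_on_SucI[OF assms(1), where f' = "\<lambda>x u. frechet_derivative f (at (h x)) (h u)"])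
    show "((\<lambda>x. f (h x)) has_derivative (\<lambda>u. frechet_derivative f (at (h x)) (h u))) (at x)"
      if "x \<in> T" for x
      using has_derivative_compose[OF bounded_linear_imp_has_derivative[OF assms(2)]]
        Ck_on_SucD(1)[OF Suc.prems] assms(3) that by blast
    show "Ck_on k T (\<lambda>x. frechet_derivative f (at (h x)) (h u))" for u
      by (rule Suc.IH[OF Ck_on_SucD(2)[OF Suc.prems]])
  qed
qed

lemma Ck_on_Times:
  assumes "open S" "open T"
  shows "Ck_on k S f \<Longrightarrow> Ck_on k (S \<times> T) (\<lambda>x. f (fst x))"
    and "Ck_on k T h \<Longrightarrow> Ck_on k (S \<times> T) (\<lambda>x. h (snd x))"
  by (rule Ck_on_compose_linear[OF open_Times[OF assms] bounded_linear_fst], auto)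
    (rule Ck_on_compose_linear[OF open_Times[OF assms] bounded_linear_snd], auto)

lemma Ck_on_Pair:
  assumes "open S" "Ck_on k S f" "Ck_on k S g"
  shows "Ck_on k S (\<lambda>x. (f x, g x))"
  using assms(2,3)
proof (induction k arbitrary: f g)
  case 0
  then show ?case by (simp add: continuous_on_Pair)
next
  case (Suc k)
  note D = Suc.prems[THEN Ck_on_SucD(1)] Suc.prems[THEN Ck_on_SucD(2)]
  show ?case
    by (rule Ck_on_SucI[OF assms(1) has_derivative_Pair[OF D(1,2)]]) (use D Suc.IH in auto)
qed

lemma Ck_on_add:
  assumes "open S" "Ck_on k S f" "Ck_on k S g"
  shows "Ck_on k S (\<lambda>x. f x + g x)"
  using Ck_on_bounded_linear[OF assms(1) _ Ck_on_Pair[OF assms],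
      where h = "\<lambda>z. fst z + snd z"]
  by (simp add: bounded_linear_add bounded_linear_fst bounded_linear_snd)

lemma Ck_on_mult:
  fixes f g :: "'e::euclidean_space \<Rightarrow> real"
  assumes "open S" "Ck_on k S f" "Ck_on k S g"
  shows "Ck_on k S (\<lambda>x. f x * g x)"
  using assms(2,3)
proof (induction k arbitrary: f g)
  case 0
  then show ?case by (simp add: continuous_on_mult)
next
  case (Suc k)
  note D = Suc.prems[THEN Ck_on_SucD(1)] Suc.prems[THEN Ck_on_SucD(2)]
  note low = Suc.prems[THEN Ck_on_Suc_imp_Ck_on]
  show ?case
    by (rule Ck_on_SucI[OF assms(1) has_derivative_mult[OF D(1,2)]])
      (use D low in \<open>auto intro!: Ck_on_add assms(1) Suc.IH\<close>)
qed


section \<open>Smooth functions and tangent vectors in charts\<close>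

lemma smooth_atlas_open_domain: "smooth_atlas A \<Longrightarrow> c \<in> A \<Longrightarrow> open (fst c)"
  unfolding smooth_atlas_def by blast

lemma smooth_atlas_open_image:
  assumes "smooth_atlas A" "c \<in> A" "open W"
  shows "open (snd c ` (fst c \<inter> W))"
proof -
  have h: "homeomorphism (fst c) (snd c ` fst c) (snd c) (chart_inv c)"
    and o: "open (snd c ` fst c)"
    using assms unfolding smooth_atlas_def by blast+
  have "openin (top_of_set (snd c ` fst c)) (snd c ` (fst c \<inter> W))"
    using homeomorphism_imp_open_map[OF h] assms(3) by (simp add: openin_open_Int)
  then show ?thesis using o openin_open_trans by blast
qed

lemma smooth_atlas_covers:
  assumes "smooth_atlas A" obtains c where "c \<in> A" "p \<in> fst c"
  using assms unfolding smooth_atlas_def by (metis UNIV_I UN_E)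

lemma smooth_atlas_chart_inv:
  assumes "smooth_atlas A" "c \<in> A" "p \<in> fst c"
  shows "chart_inv c (snd c p) = p"
  using assms unfolding smooth_atlas_def homeomorphism_def by blast

lemma smooth_fun_cong:
  assumes "smooth_atlas A" "open W" "\<And>p. p \<in> W \<Longrightarrow> f p = g p" "smooth_fun A W f"
  shows "smooth_fun A W g"
  unfolding smooth_fun_def smooth_on_def
proof (intro ballI allI)
  fix c k assume c: "c \<in> A"
  show "Ck_on k (snd c ` (fst c \<inter> W)) (g \<circ> chart_inv c)"
    by (rule Ck_on_cong[where f = "f \<circ> chart_inv c"])
      (use assms c smooth_atlas_open_image[OF assms(1) c assms(2)] smooth_atlas_chart_inv[OF assms(1) c]
        in \<open>auto simp: smooth_fun_def smooth_on_def\<close>)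
qed

lemma smooth_fun_const: "smooth_atlas A \<Longrightarrow> open W \<Longrightarrow> smooth_fun A W (\<lambda>_. r)"
  by (simp add: smooth_fun_def smooth_on_def o_def Ck_on_const smooth_atlas_open_image)

lemma smooth_fun_add:
  "\<lbrakk>smooth_atlas A; open W; smooth_fun A W f; smooth_fun A W g\<rbrakk>
    \<Longrightarrow> smooth_fun A W (\<lambda>p. f p + g p)"
  by (simp add: smooth_fun_def smooth_on_def o_def Ck_on_add smooth_atlas_open_image)

lemma smooth_fun_mult:
  "\<lbrakk>smooth_atlas A; open W; smooth_fun A W f; smooth_fun A W g\<rbrakk>
    \<Longrightarrow> smooth_fun A W (\<lambda>p. f p * g p)"
  by (simp add: smooth_fun_def smooth_on_def o_def Ck_on_mult smooth_atlas_open_image)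

lemma smooth_fun_subset: "smooth_fun A W f \<Longrightarrow> V \<subseteq> W \<Longrightarrow> smooth_fun A V f"
  unfolding smooth_fun_def smooth_on_def by (meson Ck_on_subset Int_mono image_mono order_refl)

lemma smooth_at_differentiable:
  assumes "smooth_at A p f" "c \<in> A" "p \<in> fst c"
  shows "(f \<circ> chart_inv c) differentiable at (snd c p)"
proof -
  obtain W where W: "p \<in> W" "smooth_fun A W f" using assms(1) smooth_at_def by blast
  then have "Ck_on (Suc 0) (snd c ` (fst c \<inter> W)) (f \<circ> chart_inv c)"
    using assms(2) unfolding smooth_fun_def smooth_on_def by blast
  then show ?thesis using assms(3) W(1) by simp
qed

text \<open>
  In another chart a coordinate function is a component of a transition map.
\<close>

lemma smooth_at_coordinate:
  assumes "smooth_atlas A" "c \<in> A" "p \<in> fst c"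
  shows "smooth_at A p (\<lambda>q. snd c q \<bullet> b)"
proof -
  have "Ck_on k (snd d ` (fst d \<inter> fst c)) ((\<lambda>q. snd c q \<bullet> b) \<circ> chart_inv d)"
    if d: "d \<in> A" for k d
  proof -
    have "Ck_on k (snd d ` (fst d \<inter> fst c)) (snd c \<circ> chart_inv d)"
      using assms(1,2) d unfolding smooth_atlas_def smooth_on_def by blast
    from Ck_on_bounded_linear[OF _ bounded_linear_inner_left this]
    show ?thesis using smooth_atlas_open_image[OF assms(1) d, of "fst c"]
        smooth_atlas_open_domain[OF assms(1,2)] by (simp add: o_def)
  qed
  then have "smooth_fun A (fst c) (\<lambda>q. snd c q \<bullet> b)"
    by (simp add: smooth_fun_def smooth_on_def)
  then show ?thesis
    using smooth_atlas_open_domain[OF assms(1,2)] assms(3) unfolding smooth_at_def by blast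
qed

text \<open>
  The chain rule for \<open>f \<circ> chart_inv c = (f \<circ> chart_inv d) \<circ> (snd d \<circ> chart_inv c)\<close>. It lets one
  chart around \<open>p\<close> describe all tangent vectors at \<open>p\<close>, and so makes the tangent space closed under
  linear combinations.
\<close>

lemma coord_vec_change_chart:
  assumes "smooth_atlas A" "c \<in> A" "p \<in> fst c" "d \<in> A" "p \<in> fst d"
  shows "coord_vec A c u p =
    coord_vec A d (frechet_derivative (snd d \<circ> chart_inv c) (at (snd c p)) u) p"
proof
  fix f
  let ?t = "snd d \<circ> chart_inv c"
  let ?S = "snd c ` (fst c \<inter> fst d)"
  have inv: "chart_inv c (snd c p) = p" by (rule smooth_atlas_chart_inv[OF assms(1-3)])
  have S: "open ?S" "snd c p \<in> ?S"
    using smooth_atlas_open_image[OF assms(1,2)] smooth_atlas_open_domain[OF assms(1,4)] assms(3,5)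
    by auto
  have "Ck_on (Suc 0) ?S ?t" using assms unfolding smooth_atlas_def smooth_on_def by blast
  then have t: "(?t has_derivative frechet_derivative ?t (at (snd c p))) (at (snd c p))"
    using Ck_on_SucD(1) S(2) by blast
  show "coord_vec A c u p f = coord_vec A d (frechet_derivative ?t (at (snd c p)) u) p f"
  proof (cases "smooth_at A p f")
    case True
    have "((f \<circ> chart_inv d) has_derivative frechet_derivative (f \<circ> chart_inv d) (at (snd d p)))
        (at (?t (snd c p)))"
      using smooth_at_differentiable[OF True assms(4,5)] inv by (simp add: frechet_derivative_works)
    from has_derivative_compose[OF t this]
    have "((\<lambda>z. (f \<circ> chart_inv d) (?t z)) has_derivative
      (\<lambda>u. frechet_derivative (f \<circ> chart_inv d) (at (snd d p)) (frechet_derivative ?t (at (snd c p)) u)))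
      (at (snd c p))" .
    then have "((f \<circ> chart_inv c) has_derivative
      (\<lambda>u. frechet_derivative (f \<circ> chart_inv d) (at (snd d p)) (frechet_derivative ?t (at (snd c p)) u)))
      (at (snd c p))"
      by (rule has_derivative_transform_within_open[OF _ S])
        (use assms smooth_atlas_chart_inv in \<open>fastforce simp: smooth_atlas_chart_inv\<close>)
    from frechet_derivative_eqI[OF this] show ?thesis using True by (simp add: coord_vec_def)
  qed (simp add: coord_vec_def)
qed

lemma tangent_space_eq_range:
  assumes "smooth_atlas A" "c \<in> A" "p \<in> fst c"
  shows "tangent_space A p = range (\<lambda>u. coord_vec A c u p)"
  using assms coord_vec_change_chart[OF assms(1) _ _ assms(2,3)] unfolding tangent_space_def by fastforce

lemma coord_vec_lincomb:
  assumes "c \<in> A" "p \<in> fst c"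
  shows "coord_vec A c (r *\<^sub>R u + s *\<^sub>R w) p = (\<lambda>f. r * coord_vec A c u p f + s * coord_vec A c w p f)"
proof
  fix f
  show "coord_vec A c (r *\<^sub>R u + s *\<^sub>R w) p f = r * coord_vec A c u p f + s * coord_vec A c w p f"
  proof (cases "smooth_at A p f")
    case True
    from linear_frechet_derivative[OF smooth_at_differentiable[OF True assms]]
    show ?thesis using True by (simp add: coord_vec_def linear_add linear_scale)
  qed (simp add: coord_vec_def)
qed

text \<open>A tangent vector is determined by its action on the coordinate functions.\<close>

lemma coord_vec_inject:
  assumes "smooth_atlas A" "c \<in> A" "p \<in> fst c" "coord_vec A c u p = coord_vec A c w p"
  shows "u = w"
proof -
  have "coord_vec A c x p (\<lambda>q. snd c q \<bullet> b) = x \<bullet> b" for x b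
  proof -
    let ?S = "snd c ` (fst c \<inter> UNIV)"
    have S: "open ?S" "snd c p \<in> ?S"
      using smooth_atlas_open_image[OF assms(1,2) open_UNIV] assms(3) by auto
    have "((\<lambda>z. z \<bullet> b) has_derivative (\<lambda>z. z \<bullet> b)) (at (snd c p))"
      by (intro bounded_linear_imp_has_derivative bounded_linear_inner_left)
    then have "(((\<lambda>q. snd c q \<bullet> b) \<circ> chart_inv c) has_derivative (\<lambda>z. z \<bullet> b)) (at (snd c p))"
      by (rule has_derivative_transform_within_open[OF _ S])
        (use smooth_atlas_chart_inv[OF assms(1,2)] in auto)
    from frechet_derivative_eqI[OF this] show ?thesis
      using smooth_at_coordinate[OF assms(1-3)] by (simp add: coord_vec_def)
  qed
  then show ?thesis using assms(4) by (metis vector_eq_rdot)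
qed

lemma coord_vec_in_tangent_space:
  "c \<in> A \<Longrightarrow> p \<in> fst c \<Longrightarrow> coord_vec A c u p \<in> tangent_space A p"
  unfolding tangent_space_def by blast

lemma tangent_space_lincomb:
  assumes "smooth_atlas A" "v \<in> tangent_space A p" "w \<in> tangent_space A p"
  shows "(\<lambda>f. r * v f + s * w f) \<in> tangent_space A p"
proof -
  obtain c where c: "c \<in> A" "p \<in> fst c" using smooth_atlas_covers[OF assms(1)] .
  obtain x y where "v = coord_vec A c x p" "w = coord_vec A c y p"
    using assms tangent_space_eq_range[OF assms(1) c] by blast
  then show ?thesis
    using coord_vec_lincomb[OF c, of r x s y] coord_vec_in_tangent_space[OF c] by metis
qed

lemma tangent_space_add:
  "\<lbrakk>smooth_atlas A; v \<in> tangent_space A p; w \<in> tangent_space A p\<rbrakk>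
    \<Longrightarrow> (\<lambda>f. v f + w f) \<in> tangent_space A p"
  using tangent_space_lincomb[of A v p w 1 1] by simp

lemma tangent_space_scale:
  "smooth_atlas A \<Longrightarrow> v \<in> tangent_space A p \<Longrightarrow> (\<lambda>f. r * v f) \<in> tangent_space A p"
  using tangent_space_lincomb[of A v p v r 0] by simp

lemma coord_vec_zero: "c \<in> A \<Longrightarrow> p \<in> fst c \<Longrightarrow> coord_vec A c 0 p = (\<lambda>_. 0)"
  using coord_vec_lincomb[of c A p 0 0 0 0] by simp

lemma zero_in_tangent_space:
  assumes "smooth_atlas A"
  shows "(\<lambda>_. 0) \<in> tangent_space A p"
proof -
  obtain c where c: "c \<in> A" "p \<in> fst c" using smooth_atlas_covers[OF assms] .
  show ?thesis using coord_vec_in_tangent_space[OF c, of 0] coord_vec_zero[OF c] by simp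
qed

lemma linear_form_on_lincomb:
  assumes "linear_form_on (tangent_space A p) \<beta>" "smooth_atlas A"
    "v \<in> tangent_space A p" "w \<in> tangent_space A p"
  shows "\<beta> (\<lambda>f. r * v f + s * w f) = r * \<beta> v + s * \<beta> w"
  using assms tangent_space_scale[OF assms(2)] unfolding linear_form_on_def by auto

lemma linear_form_on_zero:
  assumes "linear_form_on (tangent_space A p) \<beta>" "smooth_atlas A"
  shows "\<beta> (\<lambda>_. 0) = 0"
  using linear_form_on_lincomb[OF assms zero_in_tangent_space zero_in_tangent_space, of 0 0] assms(2)
  by simp


section \<open>Cometrics\<close>

text \<open>
  The part of a semi-Riemannian metric that lives at one point; it determines the cometric there.
\<close>

definition scalar_product_at ::
    "('a::topological_space, 'e::euclidean_space) atlas \<Rightarrow> 'a tmetric \<Rightarrow> 'a \<Rightarrow> bool" where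
  "scalar_product_at A g p \<longleftrightarrow> bilinear_form_on (tangent_space A p) (g p) \<and>
     (\<forall>v\<in>tangent_space A p. \<forall>w\<in>tangent_space A p. g p v w = g p w v) \<and>
     (\<forall>v\<in>tangent_space A p. (\<forall>w\<in>tangent_space A p. g p v w = 0) \<longrightarrow> v = (\<lambda>_. 0))"

lemma semi_riemannian_scalar_product: "semi_riemannian_metric A q g \<Longrightarrow> scalar_product_at A g p"
  unfolding semi_riemannian_metric_def scalar_product_at_def by blast

lemma scalar_product_lincomb_left:
  assumes "smooth_atlas A" "scalar_product_at A g p"
    "v \<in> tangent_space A p" "v' \<in> tangent_space A p" "w \<in> tangent_space A p"
  shows "g p (\<lambda>f. r * v f + s * v' f) w = r * g p v w + s * g p v' w"
  using linear_form_on_lincomb[where \<beta> = "\<lambda>v. g p v w", OF _ assms(1,3,4)] assms(2,5)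
  unfolding scalar_product_at_def bilinear_form_on_def by blast

text \<open>Nondegeneracy in finite dimensions represents every linear form.\<close>

lemma scalar_product_represents:
  fixes A :: "('a::{t2_space, second_countable_topology}, 'e::euclidean_space) atlas"
  assumes A: "smooth_atlas A" and g: "scalar_product_at A g p"
    and \<alpha>: "linear_form_on (tangent_space A p) \<alpha>"
  obtains v where "v \<in> tangent_space A p" "\<forall>w\<in>tangent_space A p. g p v w = \<alpha> w"
proof -
  obtain c where c: "c \<in> A" "p \<in> fst c" using smooth_atlas_covers[OF A] .
  define e where "e u = coord_vec A c u p" for u
  have T: "tangent_space A p = range e"
    unfolding e_def by (rule tangent_space_eq_range[OF A c])
  have eT: "e u \<in> tangent_space A p" for u using T by blast
  have lin_e: "linear (\<lambda>u. \<beta> (e u))" if "linear_form_on (tangent_space A p) \<beta>" for \<beta>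
  proof (rule linearI)
    show "\<beta> (e (u + w)) = \<beta> (e u) + \<beta> (e w)" for u w
      using coord_vec_lincomb[OF c, of 1 u 1 w] linear_form_on_lincomb[OF that A eT eT, of 1 u 1 w]
      by (simp add: e_def)
    show "\<beta> (e (r *\<^sub>R u)) = r *\<^sub>R \<beta> (e u)" for r u
      using coord_vec_lincomb[OF c, of r u 0 0] linear_form_on_lincomb[OF that A eT eT, of r u 0 0]
      by (simp add: e_def)
  qed
  have form: "linear_form_on (tangent_space A p) (g p (e u))"
    "linear_form_on (tangent_space A p) (\<lambda>v. g p v (e u))" for u
    using g eT[of u] unfolding scalar_product_at_def bilinear_form_on_def by simp_all
  define F where "F u = (\<Sum>b\<in>Basis. g p (e u) (e b) *\<^sub>R b)" for u
  have F_inner: "F u \<bullet> b = g p (e u) (e b)" if "b \<in> Basis" for u b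
    using that by (simp add: F_def inner_sum_left_Basis)
  have "linear (\<lambda>u. g p (e u) (e b) *\<^sub>R b)" for b
    using linear_compose[OF lin_e[OF form(2)[of b]] linear_scaleR_left[of b]] by (simp add: o_def)
  then have "linear F" unfolding F_def by (intro linear_compose_sum) blast
  moreover have "inj F"
  proof (rule linear_injective_0[OF \<open>linear F\<close>, THEN iffD2], intro allI impI)
    fix u assume "F u = 0"
    then have "g p (e u) (e b) = 0" if "b \<in> Basis" for b using F_inner[OF that, of u] by simp
    then have "(\<lambda>w. g p (e u) (e w)) = (\<lambda>_. 0)"
      by (intro linear_eq_stdbasis[OF lin_e[OF form(1)] linear_zero])
    then have "\<forall>w\<in>tangent_space A p. g p (e u) w = 0" unfolding T by (simp add: fun_eq_iff)
    with g eT[of u] have "e u = (\<lambda>_. 0)" unfolding scalar_product_at_def by simp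
    then have "coord_vec A c u p = coord_vec A c 0 p" by (simp add: e_def coord_vec_zero[OF c])
    then show "u = 0" by (rule coord_vec_inject[OF A c])
  qed
  ultimately have "surj F" by (rule eucl.linear_inj_imp_surj)
  then obtain u where u: "F u = (\<Sum>b\<in>Basis. \<alpha> (e b) *\<^sub>R b)" by (metis surjD)
  have "g p (e u) (e b) = \<alpha> (e b)" if "b \<in> Basis" for b
    using F_inner[OF that, of u] that by (simp add: u inner_sum_left_Basis)
  then have "(\<lambda>w. g p (e u) (e w)) = (\<lambda>w. \<alpha> (e w))"
    by (intro linear_eq_stdbasis[OF lin_e[OF form(1)] lin_e[OF \<alpha>]])
  then have "\<forall>w\<in>tangent_space A p. g p (e u) w = \<alpha> w" unfolding T by (simp add: fun_eq_iff)
  with eT show ?thesis by (rule that)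
qed

lemma scalar_product_eqI:
  assumes "smooth_atlas A" "scalar_product_at A g p"
    "v \<in> tangent_space A p" "v' \<in> tangent_space A p"
    "\<And>w. w \<in> tangent_space A p \<Longrightarrow> g p v w = g p v' w"
  shows "v = v'"
proof -
  have "(\<lambda>f. 1 * v f + - 1 * v' f) = (\<lambda>_. 0)"
    using scalar_product_lincomb_left[OF assms(1-4), of _ 1 "- 1"] assms(2,5)
      tangent_space_lincomb[OF assms(1,3,4), of 1 "- 1"]
    unfolding scalar_product_at_def by auto
  then show ?thesis by (simp add: fun_eq_iff)
qed

lemma metric_sharp_eqI:
  assumes "smooth_atlas A" "scalar_product_at A g p"
    "v \<in> tangent_space A p" "\<And>w. w \<in> tangent_space A p \<Longrightarrow> g p v w = \<alpha> w"
  shows "metric_sharp A g p \<alpha> = v"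
  unfolding metric_sharp_def
  by (rule the_equality) (use assms scalar_product_eqI[OF assms(1,2)] in auto)

lemma metric_sharp:
  assumes "smooth_atlas A" "scalar_product_at A g p" "\<alpha> \<in> cotangent_space A p"
  shows "metric_sharp A g p \<alpha> \<in> tangent_space A p"
    "w \<in> tangent_space A p \<Longrightarrow> g p (metric_sharp A g p \<alpha>) w = \<alpha> w"
proof -
  obtain v where "v \<in> tangent_space A p" "\<forall>w\<in>tangent_space A p. g p v w = \<alpha> w"
    using scalar_product_represents[OF assms(1,2)] assms(3) unfolding cotangent_space_def by blast
  with metric_sharp_eqI[OF assms(1,2) this(1)]
  show "metric_sharp A g p \<alpha> \<in> tangent_space A p"
    "w \<in> tangent_space A p \<Longrightarrow> g p (metric_sharp A g p \<alpha>) w = \<alpha> w"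
    by auto
qed

text \<open>
  In this form linearity in \<open>\<alpha>\<close> is evident, although \<open>cometric\<close> pairs the two dual
  vectors; symmetry of the metric then gives linearity in \<open>\<beta>\<close>.
\<close>

lemma cometric_eq_sharp:
  assumes "smooth_atlas A" "scalar_product_at A g p"
    "\<alpha> \<in> cotangent_space A p" "\<beta> \<in> cotangent_space A p"
  shows "cometric A g p \<alpha> \<beta> = \<alpha> (metric_sharp A g p \<beta>)"
  unfolding cometric_def using metric_sharp[OF assms(1,2)] assms(3,4) by blast

lemma cometric_sym:
  assumes "smooth_atlas A" "scalar_product_at A g p"
    "\<alpha> \<in> cotangent_space A p" "\<beta> \<in> cotangent_space A p"
  shows "cometric A g p \<alpha> \<beta> = cometric A g p \<beta> \<alpha>"
  unfolding cometric_def
  using metric_sharp(1)[OF assms(1,2)] assms(2-4) unfolding scalar_product_at_def by blast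

lemma cotangent_space_lincomb:
  assumes "smooth_atlas A" "\<alpha> \<in> cotangent_space A p" "\<beta> \<in> cotangent_space A p"
  shows "(\<lambda>v. r * \<alpha> v + s * \<beta> v) \<in> cotangent_space A p"
  using assms by (auto simp: cotangent_space_def linear_form_on_def algebra_simps)

lemma zero_in_cotangent_space: "(\<lambda>_. 0) \<in> cotangent_space A p"
  by (simp add: cotangent_space_def linear_form_on_def)

lemma cometric_lincomb:
  assumes "smooth_atlas A" "scalar_product_at A g p"
    "\<alpha> \<in> cotangent_space A p" "\<beta> \<in> cotangent_space A p" "\<gamma> \<in> cotangent_space A p"
  shows "cometric A g p (\<lambda>v. r * \<alpha> v + s * \<beta> v) \<gamma> = r * cometric A g p \<alpha> \<gamma> + s * cometric A g p \<beta> \<gamma>"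
    "cometric A g p \<gamma> (\<lambda>v. r * \<alpha> v + s * \<beta> v) = r * cometric A g p \<gamma> \<alpha> + s * cometric A g p \<gamma> \<beta>"
proof -
  show *: "cometric A g p (\<lambda>v. r * \<alpha> v + s * \<beta> v) \<gamma> = r * cometric A g p \<alpha> \<gamma> + s * cometric A g p \<beta> \<gamma>"
    using cometric_eq_sharp[OF assms(1,2)] cotangent_space_lincomb[OF assms(1)] assms(3-5) by simp
  show "cometric A g p \<gamma> (\<lambda>v. r * \<alpha> v + s * \<beta> v) = r * cometric A g p \<gamma> \<alpha> + s * cometric A g p \<gamma> \<beta>"
    using * cometric_sym[OF assms(1,2)] cotangent_space_lincomb[OF assms(1)] assms(3-5) by simp
qed

lemma cometric_zero_left:
  assumes "smooth_atlas A" "scalar_product_at A g p" "\<beta> \<in> cotangent_space A p"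
  shows "cometric A g p (\<lambda>_. 0) \<beta> = 0"
  by (simp add: cometric_eq_sharp[OF assms(1,2) zero_in_cotangent_space assms(3)])

text \<open>
  A subspace of the model space realises the index. The bound keeps the timelike indices
  \<open>1, \<dots>, q\<close> within the range of an orthonormal coframe.
\<close>

lemma semi_riemannian_index_le:
  fixes A :: "('a::{t2_space, second_countable_topology}, 'e::euclidean_space) atlas"
  assumes "smooth_atlas A" "semi_riemannian_metric A q g"
  shows "q \<le> DIM('e)"
proof -
  obtain c where "c \<in> A" "undefined \<in> fst c" using smooth_atlas_covers[OF assms(1)] .
  then obtain b :: "'e \<Rightarrow> 'e \<Rightarrow> real" where b: "form_index b = q"
    using assms(2) unfolding semi_riemannian_metric_def by blast
  let ?N = "{dim S |S. subspace S \<and> (\<forall>u\<in>S. u \<noteq> 0 \<longrightarrow> b u u < 0)}"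
  have le: "\<forall>n\<in>?N. n \<le> DIM('e)" using dim_subset_UNIV by blast
  then have "finite ?N" by (meson finite_nat_set_iff_bounded_le)
  moreover have "?N \<noteq> {}" using subspace_single_0 by fastforce
  ultimately show ?thesis using le b unfolding form_index_def by (metis (no_types, lifting) Max_in)
qed


section \<open>Products of manifolds\<close>

definition prod_chart :: "('a, 'e) chart \<Rightarrow> ('b, 'f) chart \<Rightarrow> ('a \<times> 'b, 'e \<times> 'f) chart" where
  "prod_chart c d = (fst c \<times> fst d, map_prod (snd c) (snd d))"

lemma prod_chart_in_prod_atlas: "c \<in> A \<Longrightarrow> d \<in> B \<Longrightarrow> prod_chart c d \<in> prod_atlas A B"
  unfolding prod_atlas_def prod_chart_def by blast

lemma prod_atlas_cases:
  assumes "C \<in> prod_atlas A B"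
  obtains c d where "C = prod_chart c d" "c \<in> A" "d \<in> B"
  using assms unfolding prod_atlas_def prod_chart_def by blast

lemma fst_prod_chart: "fst (prod_chart c d) = fst c \<times> fst d"
  by (simp add: prod_chart_def)

lemma snd_prod_chart: "snd (prod_chart c d) (p, q) = (snd c p, snd d q)"
  by (simp add: prod_chart_def)

lemma image_prod_chart: "snd (prod_chart c d) ` (S \<times> T) = (snd c ` S) \<times> (snd d ` T)"
  by (force simp: prod_chart_def)

lemma prod_chart_image_Times:
  "snd (prod_chart c d) ` (fst (prod_chart c d) \<inter> V \<times> V') =
    (snd c ` (fst c \<inter> V)) \<times> (snd d ` (fst d \<inter> V'))"
  by (simp add: fst_prod_chart Times_Int_Times image_prod_chart)

lemma chart_inv_prod_chart:
  assumes "smooth_atlas A" "smooth_atlas B" "c \<in> A" "d \<in> B"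
    "z \<in> snd c ` fst c" "w \<in> snd d ` fst d"
  shows "chart_inv (prod_chart c d) (z, w) = (chart_inv c z, chart_inv d w)"
proof -
  obtain x y where xy: "x \<in> fst c" "z = snd c x" "y \<in> fst d" "w = snd d y" using assms(5,6) by auto
  have "inj_on (snd c) (fst c)" "inj_on (snd d) (fst d)"
    using smooth_atlas_chart_inv assms by (metis inj_on_inverseI)+
  then have "inj_on (snd (prod_chart c d)) (fst (prod_chart c d))"
    unfolding prod_chart_def by (simp add: map_prod_inj_on)
  then have "chart_inv (prod_chart c d) (snd (prod_chart c d) (x, y)) = (x, y)"
    unfolding chart_inv_def by (rule inv_into_f_f) (simp add: fst_prod_chart xy)
  then show ?thesis
    using smooth_atlas_chart_inv assms(1-4) xy by (metis snd_prod_chart)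
qed

lemma homeomorphism_prod_chart:
  assumes "smooth_atlas A" "smooth_atlas B" "c \<in> A" "d \<in> B"
  shows "homeomorphism (fst (prod_chart c d)) (snd (prod_chart c d) ` fst (prod_chart c d))
    (snd (prod_chart c d)) (chart_inv (prod_chart c d))"
proof -
  have h: "homeomorphism (fst c) (snd c ` fst c) (snd c) (chart_inv c)"
    "homeomorphism (fst d) (snd d ` fst d) (snd d) (chart_inv d)"
    using assms unfolding smooth_atlas_def by blast+
  note inv = chart_inv_prod_chart[OF assms]
  have "continuous_on (fst c \<times> fst d) (\<lambda>x. (snd c (fst x), snd d (snd x)))"
    by (intro continuous_on_Pair continuous_on_compose2[OF homeomorphism_cont1[OF h(1)]]
        continuous_on_compose2[OF homeomorphism_cont1[OF h(2)]] continuous_intros) auto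
  moreover have "snd (prod_chart c d) = (\<lambda>x. (snd c (fst x), snd d (snd x)))"
    by (auto simp: prod_chart_def)
  moreover have "continuous_on ((snd c ` fst c) \<times> (snd d ` fst d))
      (\<lambda>x. (chart_inv c (fst x), chart_inv d (snd x)))"
    by (intro continuous_on_Pair continuous_on_compose2[OF homeomorphism_cont2[OF h(1)]]
        continuous_on_compose2[OF homeomorphism_cont2[OF h(2)]] continuous_intros) auto
  then have "continuous_on ((snd c ` fst c) \<times> (snd d ` fst d)) (chart_inv (prod_chart c d))"
    by (rule continuous_on_eq) (use inv in auto)
  ultimately show ?thesis
    unfolding fst_prod_chart image_prod_chart
    using inv smooth_atlas_chart_inv[OF assms(1,3)] smooth_atlas_chart_inv[OF assms(2,4)]
    by (intro homeomorphismI) auto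
qed

lemma smooth_atlas_prod:
  fixes A :: "('a::{t2_space, second_countable_topology}, 'e::euclidean_space) atlas"
    and B :: "('b::{t2_space, second_countable_topology}, 'f::euclidean_space) atlas"
  assumes A: "smooth_atlas A" and B: "smooth_atlas B"
  shows "smooth_atlas (prod_atlas A B)"
  unfolding smooth_atlas_def
proof (intro conjI ballI)
  show "(\<Union>c\<in>prod_atlas A B. fst c) = UNIV"
  proof (intro set_eqI iffI)
    fix x :: "'a \<times> 'b"
    obtain c d where "c \<in> A" "fst x \<in> fst c" "d \<in> B" "snd x \<in> fst d"
      using smooth_atlas_covers[OF A] smooth_atlas_covers[OF B] by metis
    then have "prod_chart c d \<in> prod_atlas A B" "x \<in> fst (prod_chart c d)"
      by (auto simp: prod_chart_in_prod_atlas fst_prod_chart mem_Times_iff)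
    then show "x \<in> (\<Union>c\<in>prod_atlas A B. fst c)" by blast
  qed simp
  fix C assume "C \<in> prod_atlas A B"
  then obtain c d where C: "C = prod_chart c d" "c \<in> A" "d \<in> B" by (rule prod_atlas_cases)
  show "open (fst C)"
    using C smooth_atlas_open_domain[OF A] smooth_atlas_open_domain[OF B]
    by (simp add: fst_prod_chart open_Times)
  show "open (snd C ` fst C)"
    using C smooth_atlas_open_image[OF A, of c UNIV] smooth_atlas_open_image[OF B, of d UNIV]
    by (simp add: fst_prod_chart image_prod_chart open_Times)
  show "homeomorphism (fst C) (snd C ` fst C) (snd C) (chart_inv C)"
    using homeomorphism_prod_chart[OF A B] C by simp
  fix C' assume "C' \<in> prod_atlas A B"
  then obtain c' d' where C': "C' = prod_chart c' d'" "c' \<in> A" "d' \<in> B" by (rule prod_atlas_cases)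
  let ?S = "snd c ` (fst c \<inter> fst c')" and ?T = "snd d ` (fst d \<inter> fst d')"
  have op: "open ?S" "open ?T"
    using smooth_atlas_open_image[OF A C(2) smooth_atlas_open_domain[OF A C'(2)]]
      smooth_atlas_open_image[OF B C(3) smooth_atlas_open_domain[OF B C'(3)]] .
  have ST: "snd C ` (fst C \<inter> fst C') = ?S \<times> ?T"
    unfolding C(1) C'(1) by (simp only: fst_prod_chart[of c' d'] prod_chart_image_Times)
  have "Ck_on k (?S \<times> ?T) (snd C' \<circ> chart_inv C)" for k
  proof (rule Ck_on_cong)
    show "open (?S \<times> ?T)" using op by (rule open_Times)
    have "Ck_on k ?S (snd c' \<circ> chart_inv c)" "Ck_on k ?T (snd d' \<circ> chart_inv d)"
      using A B C C' unfolding smooth_atlas_def smooth_on_def by blast+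
    then show "Ck_on k (?S \<times> ?T)
        (\<lambda>x. ((snd c' \<circ> chart_inv c) (fst x), (snd d' \<circ> chart_inv d) (snd x)))"
      by (intro Ck_on_Pair Ck_on_Times open_Times op)
    show "((snd c' \<circ> chart_inv c) (fst x), (snd d' \<circ> chart_inv d) (snd x)) = (snd C' \<circ> chart_inv C) x"
      if "x \<in> ?S \<times> ?T" for x
      using that chart_inv_prod_chart[OF A B C(2,3), of "fst x" "snd x"]
      by (auto simp: C(1) C'(1) snd_prod_chart)
  qed
  then show "smooth_on (snd C ` (fst C \<inter> fst C')) (snd C' \<circ> chart_inv C)"
    by (simp add: ST smooth_on_def)
qed

context
  fixes A :: "('a::{t2_space, second_countable_topology}, 'e::euclidean_space) atlas"
    and B :: "('b::{t2_space, second_countable_topology}, 'f::euclidean_space) atlas"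
  assumes A: "smooth_atlas A" and B: "smooth_atlas B"
begin

lemma smooth_fun_Times:
  assumes V: "open V" "open V'"
  shows "smooth_fun A V f \<Longrightarrow> smooth_fun (prod_atlas A B) (V \<times> V') (\<lambda>x. f (fst x))"
    and "smooth_fun B V' h \<Longrightarrow> smooth_fun (prod_atlas A B) (V \<times> V') (\<lambda>x. h (snd x))"
proof -
  have "Ck_on k (snd C ` (fst C \<inter> V \<times> V')) ((\<lambda>x. f (fst x)) \<circ> chart_inv C)"
    if f: "smooth_fun A V f" and "C \<in> prod_atlas A B" for C k
  proof -
    obtain c d where C: "C = prod_chart c d" "c \<in> A" "d \<in> B" using \<open>C \<in> _\<close> by (rule prod_atlas_cases)
    let ?S = "snd c ` (fst c \<inter> V)" and ?T = "snd d ` (fst d \<inter> V')"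
    have op: "open ?S" "open ?T"
      using smooth_atlas_open_image[OF A C(2) V(1)] smooth_atlas_open_image[OF B C(3) V(2)] .
    have "Ck_on k ?S (f \<circ> chart_inv c)" using f C unfolding smooth_fun_def smooth_on_def by blast
    then have "Ck_on k (?S \<times> ?T) (\<lambda>x. (f \<circ> chart_inv c) (fst x))"
      by (rule Ck_on_Times(1)[OF op])
    then have "Ck_on k (?S \<times> ?T) ((\<lambda>x. f (fst x)) \<circ> chart_inv C)"
      by (rule Ck_on_cong[OF open_Times[OF op], rotated])
        (use chart_inv_prod_chart[OF A B C(2,3)] in \<open>force simp: C(1)\<close>)
    then show ?thesis unfolding C(1) prod_chart_image_Times .
  qed
  then show "smooth_fun A V f \<Longrightarrow> smooth_fun (prod_atlas A B) (V \<times> V') (\<lambda>x. f (fst x))"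
    by (simp add: smooth_fun_def smooth_on_def)
next
  have "Ck_on k (snd C ` (fst C \<inter> V \<times> V')) ((\<lambda>x. h (snd x)) \<circ> chart_inv C)"
    if h: "smooth_fun B V' h" and "C \<in> prod_atlas A B" for C k
  proof -
    obtain c d where C: "C = prod_chart c d" "c \<in> A" "d \<in> B" using \<open>C \<in> _\<close> by (rule prod_atlas_cases)
    let ?S = "snd c ` (fst c \<inter> V)" and ?T = "snd d ` (fst d \<inter> V')"
    have op: "open ?S" "open ?T"
      using smooth_atlas_open_image[OF A C(2) V(1)] smooth_atlas_open_image[OF B C(3) V(2)] .
    have "Ck_on k ?T (h \<circ> chart_inv d)" using h C unfolding smooth_fun_def smooth_on_def by blast
    then have "Ck_on k (?S \<times> ?T) (\<lambda>x. (h \<circ> chart_inv d) (snd x))"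
      by (rule Ck_on_Times(2)[OF op])
    then have "Ck_on k (?S \<times> ?T) ((\<lambda>x. h (snd x)) \<circ> chart_inv C)"
      by (rule Ck_on_cong[OF open_Times[OF op], rotated])
        (use chart_inv_prod_chart[OF A B C(2,3)] in \<open>force simp: C(1)\<close>)
    then show ?thesis unfolding C(1) prod_chart_image_Times .
  qed
  then show "smooth_fun B V' h \<Longrightarrow> smooth_fun (prod_atlas A B) (V \<times> V') (\<lambda>x. h (snd x))"
    by (simp add: smooth_fun_def smooth_on_def)
qed

lemma smooth_at_Times:
  "smooth_at A p f \<Longrightarrow> smooth_at (prod_atlas A B) (p, q) (f \<circ> fst)"
  "smooth_at B q h \<Longrightarrow> smooth_at (prod_atlas A B) (p, q) (h \<circ> snd)"
proof -
  assume "smooth_at A p f"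
  then obtain V where "open V" "p \<in> V" "smooth_fun A V f" unfolding smooth_at_def by blast
  then show "smooth_at (prod_atlas A B) (p, q) (f \<circ> fst)"
    using smooth_fun_Times(1)[of V UNIV f] unfolding smooth_at_def o_def
    by (intro exI[of _ "V \<times> UNIV"]) (auto simp: open_Times)
next
  assume "smooth_at B q h"
  then obtain V where "open V" "q \<in> V" "smooth_fun B V h" unfolding smooth_at_def by blast
  then show "smooth_at (prod_atlas A B) (p, q) (h \<circ> snd)"
    using smooth_fun_Times(2)[of UNIV V h] unfolding smooth_at_def o_def
    by (intro exI[of _ "UNIV \<times> V"]) (auto simp: open_Times)
qed

text \<open>
  Near \<open>p\<close>, the function \<open>f \<circ> fst\<close> read in a product chart is \<open>f\<close> read in the first chart, composed
  with the linear map \<open>fst\<close>; so the derivative sees the first component of \<open>(u, w)\<close> only.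
\<close>

lemma pushforward_coord_vec:
  fixes u :: 'e and w :: 'f and p :: 'a and q :: 'b
  assumes c: "c \<in> A" "p \<in> fst c" and d: "d \<in> B" "q \<in> fst d"
  defines "v \<equiv> coord_vec (prod_atlas A B) (prod_chart c d) (u, w) (p, q)"
  shows "pushforward A fst (p, q) v = coord_vec A c u p"
    and "pushforward B snd (p, q) v = coord_vec B d w q"
proof -
  let ?S = "(snd c ` fst c) \<times> (snd d ` fst d)"
  have S: "open ?S" "(snd c p, snd d q) \<in> ?S"
    using open_Times smooth_atlas_open_image[OF A c(1) open_UNIV] smooth_atlas_open_image[OF B d(1) open_UNIV]
      c(2) d(2) by auto
  note inv = chart_inv_prod_chart[OF A B c(1) d(1)]
  have "v (f \<circ> fst) = coord_vec A c u p f" if f: "smooth_at A p f" for f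
  proof -
    have "((f \<circ> chart_inv c) has_derivative frechet_derivative (f \<circ> chart_inv c) (at (snd c p)))
        (at (fst (snd c p, snd d q)))"
      using smooth_at_differentiable[OF f c] by (simp add: frechet_derivative_works)
    from has_derivative_compose[OF bounded_linear_imp_has_derivative[OF bounded_linear_fst] this]
    have "(((f \<circ> fst) \<circ> chart_inv (prod_chart c d)) has_derivative
        (\<lambda>x. frechet_derivative (f \<circ> chart_inv c) (at (snd c p)) (fst x))) (at (snd c p, snd d q))"
      by (rule has_derivative_transform_within_open[OF _ S]) (use inv in force)
    from frechet_derivative_eqI[OF this] show ?thesis
      using f smooth_at_Times(1)[OF f] by (simp add: v_def coord_vec_def snd_prod_chart)
  qed
  then show "pushforward A fst (p, q) v = coord_vec A c u p"
    by (auto simp: pushforward_def coord_vec_def fun_eq_iff)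
  have "v (h \<circ> snd) = coord_vec B d w q h" if h: "smooth_at B q h" for h
  proof -
    have "((h \<circ> chart_inv d) has_derivative frechet_derivative (h \<circ> chart_inv d) (at (snd d q)))
        (at (snd (snd c p, snd d q)))"
      using smooth_at_differentiable[OF h d] by (simp add: frechet_derivative_works)
    from has_derivative_compose[OF bounded_linear_imp_has_derivative[OF bounded_linear_snd] this]
    have "(((h \<circ> snd) \<circ> chart_inv (prod_chart c d)) has_derivative
        (\<lambda>x. frechet_derivative (h \<circ> chart_inv d) (at (snd d q)) (snd x))) (at (snd c p, snd d q))"
      by (rule has_derivative_transform_within_open[OF _ S]) (use inv in force)
    from frechet_derivative_eqI[OF this] show ?thesis
      using h smooth_at_Times(2)[OF h] by (simp add: v_def coord_vec_def snd_prod_chart)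
  qed
  then show "pushforward B snd (p, q) v = coord_vec B d w q"
    by (auto simp: pushforward_def coord_vec_def fun_eq_iff)
qed

lemma prod_tangent_vector_cases:
  assumes "v \<in> tangent_space (prod_atlas A B) (p, q)"
  obtains c d u w where "c \<in> A" "p \<in> fst c" "d \<in> B" "q \<in> fst d"
    "v = coord_vec (prod_atlas A B) (prod_chart c d) (u, w) (p, q)"
proof -
  obtain C z where C: "C \<in> prod_atlas A B" "(p, q) \<in> fst C" "v = coord_vec (prod_atlas A B) C z (p, q)"
    using assms unfolding tangent_space_def by blast
  obtain c d where "C = prod_chart c d" "c \<in> A" "d \<in> B" using C(1) by (rule prod_atlas_cases)
  then show ?thesis using C that[of c d "fst z" "snd z"] by (simp add: fst_prod_chart)
qed

lemma pushforward_in_tangent_space: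
  assumes "v \<in> tangent_space (prod_atlas A B) x"
  shows "pushforward A fst x v \<in> tangent_space A (fst x)"
    and "pushforward B snd x v \<in> tangent_space B (snd x)"
  using prod_tangent_vector_cases[of v "fst x" "snd x"] assms pushforward_coord_vec
    coord_vec_in_tangent_space by (metis prod.collapse)+

text \<open>
  This lemma and the next say that the two push-forwards identify the tangent space of the product
  with the direct sum of the tangent spaces of the factors.
\<close>

lemma prod_tangent_vector_exists:
  assumes "v1 \<in> tangent_space A (fst x)" "v2 \<in> tangent_space B (snd x)"
  obtains v where "v \<in> tangent_space (prod_atlas A B) x"
    "pushforward A fst x v = v1" "pushforward B snd x v = v2"
proof -
  obtain c u where c: "c \<in> A" "fst x \<in> fst c" "v1 = coord_vec A c u (fst x)"
    using assms(1) unfolding tangent_space_def by blast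
  obtain d w where d: "d \<in> B" "snd x \<in> fst d" "v2 = coord_vec B d w (snd x)"
    using assms(2) unfolding tangent_space_def by blast
  have "coord_vec (prod_atlas A B) (prod_chart c d) (u, w) x \<in> tangent_space (prod_atlas A B) x"
    by (rule coord_vec_in_tangent_space)
      (use c d in \<open>auto simp: prod_chart_in_prod_atlas fst_prod_chart mem_Times_iff\<close>)
  then show ?thesis
    using that pushforward_coord_vec[OF c(1,2) d(1,2), of u w] c(3) d(3) by simp
qed

lemma prod_tangent_vector_zero:
  assumes "v \<in> tangent_space (prod_atlas A B) x"
    "pushforward A fst x v = (\<lambda>_. 0)" "pushforward B snd x v = (\<lambda>_. 0)"
  shows "v = (\<lambda>_. 0)"
proof -
  obtain p q where x: "x = (p, q)" by fastforce
  obtain c d u w where c: "c \<in> A" "p \<in> fst c" and d: "d \<in> B" "q \<in> fst d"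
    and v: "v = coord_vec (prod_atlas A B) (prod_chart c d) (u, w) (p, q)"
    using prod_tangent_vector_cases assms(1) unfolding x by blast
  have "coord_vec A c u p = coord_vec A c 0 p" "coord_vec B d w q = coord_vec B d 0 q"
    using assms(2,3) pushforward_coord_vec[OF c d, of u w] coord_vec_zero[OF c] coord_vec_zero[OF d]
    unfolding x v by simp_all
  then have "u = 0" "w = 0" using coord_vec_inject[OF A c] coord_vec_inject[OF B d] by blast+
  then show ?thesis
    using v coord_vec_zero[of "prod_chart c d" "prod_atlas A B" "(p, q)"] c d
    by (simp add: prod_chart_in_prod_atlas fst_prod_chart zero_prod_def)
qed

end

lemma pushforward_lincomb:
  "pushforward B F p (\<lambda>f. r * v f + s * w f) =
    (\<lambda>f. r * pushforward B F p v f + s * pushforward B F p w f)"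
  by (auto simp: pushforward_def)


section \<open>The warped cometric\<close>

text \<open>
  Nondegeneracy is seen by pairing with the vectors that have one vanishing push-forward; for the
  vertical ones this uses that the factor \<open>f\<^sup>2\<close> is not zero.
\<close>

lemma warped_metric_scalar_product:
  assumes A: "smooth_atlas A" and B: "smooth_atlas B"
    and g1: "scalar_product_at A g1 (fst x)" and g2: "scalar_product_at B g2 (snd x)"
    and f: "f (fst x) \<noteq> 0"
  shows "scalar_product_at (prod_atlas A B) (warped_metric A B g1 f g2) x"
proof -
  let ?T = "tangent_space (prod_atlas A B) x"
  let ?G = "warped_metric A B g1 f g2"
  let ?a = "pushforward A fst x" and ?b = "pushforward B snd x"
  note push = pushforward_in_tangent_space[OF A B]
  have sym: "?G x v w = ?G x w v" if "v \<in> ?T" "w \<in> ?T" for v w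
    using g1 g2 push[OF that(1)] push[OF that(2)] by (simp add: warped_metric_def scalar_product_at_def)
  have lin: "?G x (\<lambda>h. r * v h + s * v' h) w = r * ?G x v w + s * ?G x v' w"
    if "v \<in> ?T" "v' \<in> ?T" "w \<in> ?T" for v v' w r s
    using scalar_product_lincomb_left[OF A g1 push(1)[OF that(1)] push(1)[OF that(2)] push(1)[OF that(3)]]
      scalar_product_lincomb_left[OF B g2 push(2)[OF that(1)] push(2)[OF that(2)] push(2)[OF that(3)]]
    by (simp add: warped_metric_def pushforward_lincomb algebra_simps)
  have left: "linear_form_on ?T (\<lambda>v. ?G x v w)" if "w \<in> ?T" for w
    using lin[OF _ _ that, of _ _ 1 1] lin[OF _ _ that, of _ _ _ 0] by (auto simp: linear_form_on_def)
  have right: "linear_form_on ?T (?G x v)" if "v \<in> ?T" for v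
    using left[OF that] sym[OF that] tangent_space_add[OF smooth_atlas_prod[OF A B]]
      tangent_space_scale[OF smooth_atlas_prod[OF A B]]
    unfolding linear_form_on_def by simp
  have nondeg: "v = (\<lambda>_. 0)" if v: "v \<in> ?T" and orth: "\<forall>w\<in>?T. ?G x v w = 0" for v
  proof (rule prod_tangent_vector_zero[OF A B v])
    have "g1 (fst x) (?a v) w1 = 0" if w1: "w1 \<in> tangent_space A (fst x)" for w1
    proof -
      obtain w where w: "w \<in> ?T" "?a w = w1" "?b w = (\<lambda>_. 0)"
        using prod_tangent_vector_exists[OF A B w1 zero_in_tangent_space[OF B]] .
      have "g2 (snd x) (?b v) (\<lambda>_. 0) = 0"
        using linear_form_on_zero[OF _ B] g2 push(2)[OF v]
        unfolding scalar_product_at_def bilinear_form_on_def by blast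
      then show ?thesis using orth w by (force simp: warped_metric_def)
    qed
    then show "?a v = (\<lambda>_. 0)" using g1 push(1)[OF v] unfolding scalar_product_at_def by blast
    have "g2 (snd x) (?b v) w2 = 0" if w2: "w2 \<in> tangent_space B (snd x)" for w2
    proof -
      obtain w where w: "w \<in> ?T" "?a w = (\<lambda>_. 0)" "?b w = w2"
        using prod_tangent_vector_exists[OF A B zero_in_tangent_space[OF A] w2] .
      have "g1 (fst x) (?a v) (\<lambda>_. 0) = 0"
        using linear_form_on_zero[OF _ A] g1 push(1)[OF v]
        unfolding scalar_product_at_def bilinear_form_on_def by blast
      then show ?thesis using orth w f by (force simp: warped_metric_def)
    qed
    then show "?b v = (\<lambda>_. 0)" using g2 push(2)[OF v] unfolding scalar_product_at_def by blast
  qed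
  show ?thesis
    unfolding scalar_product_at_def bilinear_form_on_def using left right sym nondeg by blast
qed

lemma pullback_covec_in_cotangent_space:
  assumes "smooth_atlas A" "\<And>v. v \<in> tangent_space A x \<Longrightarrow> pushforward B F x v \<in> tangent_space B (F x)"
    "\<alpha> \<in> cotangent_space B (F x)"
  shows "pullback_covec A B F x \<alpha> \<in> cotangent_space A x"
proof -
  have "pushforward B F x (\<lambda>f. v f + w f) = (\<lambda>f. pushforward B F x v f + pushforward B F x w f)"
    "pushforward B F x (\<lambda>f. r * v f) = (\<lambda>f. r * pushforward B F x v f)" for v w r
    using pushforward_lincomb[of B F x 1 v 1 w] pushforward_lincomb[of B F x r v 0 v] by simp_all
  then show ?thesis
    using assms tangent_space_add[OF assms(1)] tangent_space_scale[OF assms(1)]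
    by (simp add: cotangent_space_def pullback_covec_def linear_form_on_def)
qed

context
  fixes A :: "('a::{t2_space, second_countable_topology}, 'e::euclidean_space) atlas"
    and B :: "('b::{t2_space, second_countable_topology}, 'f::euclidean_space) atlas"
    and g1 :: "'a tmetric" and g2 :: "'b tmetric" and f :: "'a \<Rightarrow> real" and x :: "'a \<times> 'b"
  assumes A: "smooth_atlas A" and B: "smooth_atlas B"
    and g1: "scalar_product_at A g1 (fst x)" and g2: "scalar_product_at B g2 (snd x)"
    and f: "f (fst x) \<noteq> 0"
begin

lemma lifts_in_cotangent_space:
  "\<alpha> (fst x) \<in> cotangent_space A (fst x) \<Longrightarrow> hlift A B \<alpha> x \<in> cotangent_space (prod_atlas A B) x"
  "\<beta> (snd x) \<in> cotangent_space B (snd x) \<Longrightarrow>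
    form_mult (f \<circ> fst) (vlift A B \<beta>) x \<in> cotangent_space (prod_atlas A B) x"
proof -
  note push = pushforward_in_tangent_space[OF A B]
  note AB = smooth_atlas_prod[OF A B]
  show "hlift A B \<alpha> x \<in> cotangent_space (prod_atlas A B) x"
    if "\<alpha> (fst x) \<in> cotangent_space A (fst x)"
    unfolding hlift_def by (rule pullback_covec_in_cotangent_space[OF AB push(1) that])
  have "vlift A B \<beta> x \<in> cotangent_space (prod_atlas A B) x"
    if "\<beta> (snd x) \<in> cotangent_space B (snd x)"
    unfolding vlift_def by (rule pullback_covec_in_cotangent_space[OF AB push(2) that])
  then show "form_mult (f \<circ> fst) (vlift A B \<beta>) x \<in> cotangent_space (prod_atlas A B) x"
    if "\<beta> (snd x) \<in> cotangent_space B (snd x)"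
    using that cotangent_space_lincomb[OF AB, of "vlift A B \<beta> x" x "vlift A B \<beta> x" "f (fst x)" 0]
    by (simp add: form_mult_def)
qed

text \<open>
  The vector dual to \<open>\<alpha>\<^sup>h\<close> is horizontal over the one dual to \<open>\<alpha>\<close>; the vector dual to \<open>f \<beta>\<^sup>v\<close> is
  vertical over \<open>1 / f\<close> times the one dual to \<open>\<beta>\<close>, because the metric of the fibre carries the
  factor \<open>f\<^sup>2\<close>.
\<close>

lemma metric_sharp_hlift:
  assumes \<alpha>: "\<alpha> (fst x) \<in> cotangent_space A (fst x)"
  defines "v \<equiv> metric_sharp (prod_atlas A B) (warped_metric A B g1 f g2) x (hlift A B \<alpha> x)"
  shows "v \<in> tangent_space (prod_atlas A B) x"
    "pushforward A fst x v = metric_sharp A g1 (fst x) (\<alpha> (fst x))"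
    "pushforward B snd x v = (\<lambda>_. 0)"
proof -
  note push = pushforward_in_tangent_space[OF A B]
  note sharp = metric_sharp[OF A g1 \<alpha>]
  obtain w where w: "w \<in> tangent_space (prod_atlas A B) x"
    "pushforward A fst x w = metric_sharp A g1 (fst x) (\<alpha> (fst x))"
    "pushforward B snd x w = (\<lambda>_. 0)"
    using prod_tangent_vector_exists[OF A B sharp(1) zero_in_tangent_space[OF B]] .
  have "v = w"
    unfolding v_def
  proof (rule metric_sharp_eqI[OF smooth_atlas_prod[OF A B] warped_metric_scalar_product[where f = f]])
    fix u assume u: "u \<in> tangent_space (prod_atlas A B) x"
    have "g2 (snd x) (\<lambda>_. 0) (pushforward B snd x u) = 0"
      using scalar_product_lincomb_left[OF B g2 zero_in_tangent_space[OF B]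
          zero_in_tangent_space[OF B] push(2)[OF u], of 0 0] by simp
    then show "warped_metric A B g1 f g2 x w u = hlift A B \<alpha> x u"
      using w u sharp(2)[OF push(1)[OF u]]
      by (simp add: warped_metric_def hlift_def pullback_covec_def)
  qed (use A B g1 g2 f w in auto)
  then show "v \<in> tangent_space (prod_atlas A B) x"
    "pushforward A fst x v = metric_sharp A g1 (fst x) (\<alpha> (fst x))"
    "pushforward B snd x v = (\<lambda>_. 0)"
    using w by simp_all
qed

lemma metric_sharp_vlift:
  assumes \<beta>: "\<beta> (snd x) \<in> cotangent_space B (snd x)"
  defines "v \<equiv> metric_sharp (prod_atlas A B) (warped_metric A B g1 f g2) x
    (form_mult (f \<circ> fst) (vlift A B \<beta>) x)"
  shows "v \<in> tangent_space (prod_atlas A B) x"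
    "pushforward A fst x v = (\<lambda>_. 0)"
    "pushforward B snd x v = (\<lambda>h. 1 / f (fst x) * metric_sharp B g2 (snd x) (\<beta> (snd x)) h)"
proof -
  note push = pushforward_in_tangent_space[OF A B]
  note sharp = metric_sharp[OF B g2 \<beta>]
  let ?s = "\<lambda>h. 1 / f (fst x) * metric_sharp B g2 (snd x) (\<beta> (snd x)) h"
  have s: "?s \<in> tangent_space B (snd x)"
    using tangent_space_lincomb[OF B sharp(1) sharp(1), of "1 / f (fst x)" 0] by simp
  obtain w where w: "w \<in> tangent_space (prod_atlas A B) x"
    "pushforward A fst x w = (\<lambda>_. 0)" "pushforward B snd x w = ?s"
    using prod_tangent_vector_exists[OF A B zero_in_tangent_space[OF A] s] .
  have "v = w"
    unfolding v_def
  proof (rule metric_sharp_eqI[OF smooth_atlas_prod[OF A B] warped_metric_scalar_product[where f = f]])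
    fix u assume u: "u \<in> tangent_space (prod_atlas A B) x"
    have "g1 (fst x) (\<lambda>_. 0) (pushforward A fst x u) = 0"
      using scalar_product_lincomb_left[OF A g1 zero_in_tangent_space[OF A]
          zero_in_tangent_space[OF A] push(1)[OF u], of 0 0] by simp
    moreover have "g2 (snd x) ?s (pushforward B snd x u) =
        1 / f (fst x) * \<beta> (snd x) (pushforward B snd x u)"
      using scalar_product_lincomb_left[OF B g2 sharp(1) sharp(1) push(2)[OF u], of "1 / f (fst x)" 0]
        sharp(2)[OF push(2)[OF u]] by simp
    ultimately show "warped_metric A B g1 f g2 x w u = form_mult (f \<circ> fst) (vlift A B \<beta>) x u"
      unfolding warped_metric_def w(2,3)
      using u f by (simp add: form_mult_def vlift_def pullback_covec_def power2_eq_square)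
  qed (use A B g1 g2 f w in auto)
  then show "v \<in> tangent_space (prod_atlas A B) x"
    "pushforward A fst x v = (\<lambda>_. 0)" "pushforward B snd x v = ?s"
    using w by simp_all
qed

lemmas prod_scalar_product = warped_metric_scalar_product[where f = f, OF A B g1 g2 f]
lemmas prod_cometric_eq = cometric_eq_sharp[OF smooth_atlas_prod[OF A B] prod_scalar_product]

lemma warped_cometric_horizontal:
  assumes \<alpha>: "\<alpha> (fst x) \<in> cotangent_space A (fst x)" "\<alpha>' (fst x) \<in> cotangent_space A (fst x)"
  shows "cometric (prod_atlas A B) (warped_metric A B g1 f g2) x (hlift A B \<alpha> x) (hlift A B \<alpha>' x) = cometric A g1 (fst x) (\<alpha> (fst x)) (\<alpha>' (fst x))"
  using metric_sharp_hlift[of \<alpha>', OF \<alpha>(2)] cometric_eq_sharp[OF A g1 \<alpha>]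
    prod_cometric_eq[OF lifts_in_cotangent_space(1)[of \<alpha>, OF \<alpha>(1)] lifts_in_cotangent_space(1)[of \<alpha>', OF \<alpha>(2)]]
  by (simp add: hlift_def pullback_covec_def)

lemma warped_cometric_vertical:
  assumes \<beta>: "\<beta> (snd x) \<in> cotangent_space B (snd x)" "\<beta>' (snd x) \<in> cotangent_space B (snd x)"
  shows "cometric (prod_atlas A B) (warped_metric A B g1 f g2) x (form_mult (f \<circ> fst) (vlift A B \<beta>) x) (form_mult (f \<circ> fst) (vlift A B \<beta>') x) =
    cometric B g2 (snd x) (\<beta> (snd x)) (\<beta>' (snd x))"
proof -
  have "\<beta> (snd x) (\<lambda>h. 1 / f (fst x) * metric_sharp B g2 (snd x) (\<beta>' (snd x)) h) =
      1 / f (fst x) * \<beta> (snd x) (metric_sharp B g2 (snd x) (\<beta>' (snd x)))"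
    using \<beta>(1) metric_sharp(1)[OF B g2 \<beta>(2)] unfolding cotangent_space_def linear_form_on_def by blast
  then show ?thesis
    unfolding cometric_eq_sharp[OF B g2 \<beta>]
      prod_cometric_eq[OF lifts_in_cotangent_space(2)[of \<beta>, OF \<beta>(1)] lifts_in_cotangent_space(2)[of \<beta>', OF \<beta>(2)]]
    using metric_sharp_vlift[of \<beta>', OF \<beta>(2)] f
    by (simp add: form_mult_def[of _ "vlift A B \<beta>"] vlift_def[of A B \<beta>] pullback_covec_def)
qed

lemma warped_cometric_mixed:
  assumes \<alpha>: "\<alpha> (fst x) \<in> cotangent_space A (fst x)" and \<beta>: "\<beta> (snd x) \<in> cotangent_space B (snd x)"
  shows "cometric (prod_atlas A B) (warped_metric A B g1 f g2) x (hlift A B \<alpha> x) (form_mult (f \<circ> fst) (vlift A B \<beta>) x) = 0"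
    and "cometric (prod_atlas A B) (warped_metric A B g1 f g2) x (form_mult (f \<circ> fst) (vlift A B \<beta>) x) (hlift A B \<alpha> x) = 0"
proof -
  note cot = lifts_in_cotangent_space(1)[of \<alpha>, OF \<alpha>] lifts_in_cotangent_space(2)[of \<beta>, OF \<beta>]
  have "linear_form_on (tangent_space A (fst x)) (\<alpha> (fst x))"
    using \<alpha> unfolding cotangent_space_def by blast
  then show "cometric (prod_atlas A B) (warped_metric A B g1 f g2) x (hlift A B \<alpha> x) (form_mult (f \<circ> fst) (vlift A B \<beta>) x) = 0"
    using metric_sharp_vlift[of \<beta>, OF \<beta>] prod_cometric_eq[OF cot] linear_form_on_zero[OF _ A]
    by (simp add: hlift_def pullback_covec_def)
  then show "cometric (prod_atlas A B) (warped_metric A B g1 f g2) x (form_mult (f \<circ> fst) (vlift A B \<beta>) x) (hlift A B \<alpha> x) = 0"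
    using cometric_sym[OF smooth_atlas_prod[OF A B] prod_scalar_product cot] by simp
qed

end


section \<open>One-forms\<close>

definition form_lincomb :: "real \<Rightarrow> 'a form \<Rightarrow> real \<Rightarrow> 'a form \<Rightarrow> 'a form" where
  "form_lincomb a \<omega> b \<eta> = (\<lambda>p v. a * \<omega> p v + b * \<eta> p v)"

lemma one_form_cotangent: "one_form A W \<omega> \<Longrightarrow> p \<in> W \<Longrightarrow> \<omega> p \<in> cotangent_space A p"
  unfolding one_form_def by blast

lemma one_form_smooth_lincomb:
  assumes A: "smooth_atlas A" "open W" and fs: "smooth_fun A W f" "smooth_fun A W h"
    and forms: "one_form A W \<omega>" "one_form A W \<eta>"
  shows "one_form A W (\<lambda>p v. f p * \<omega> p v + h p * \<eta> p v)"
  unfolding one_form_def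
proof (intro conjI ballI allI)
  show "(\<lambda>v. f p * \<omega> p v + h p * \<eta> p v) \<in> cotangent_space A p" if "p \<in> W" for p
    using cotangent_space_lincomb[OF A(1)] one_form_cotangent forms that by blast
  fix c u assume c: "c \<in> A"
  have "open (W \<inter> fst c)" using A c smooth_atlas_open_domain by blast
  moreover have "smooth_fun A (W \<inter> fst c) f" "smooth_fun A (W \<inter> fst c) h"
    using fs smooth_fun_subset by blast+
  ultimately show "smooth_fun A (W \<inter> fst c)
      (\<lambda>p. f p * \<omega> p (coord_vec A c u p) + h p * \<eta> p (coord_vec A c u p))"
    using forms c unfolding one_form_def by (intro smooth_fun_add smooth_fun_mult A) blast+
qed

lemma one_form_lincomb:
  "\<lbrakk>smooth_atlas A; open W; one_form A W \<omega>; one_form A W \<eta>\<rbrakk> \<Longrightarrow> one_form A W (form_lincomb a \<omega> b \<eta>)"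
  unfolding form_lincomb_def by (rule one_form_smooth_lincomb) (auto intro: smooth_fun_const)

lemma one_form_mult:
  "\<lbrakk>smooth_atlas A; open W; smooth_fun A W f; one_form A W \<omega>\<rbrakk> \<Longrightarrow> one_form A W (form_mult f \<omega>)"
  using one_form_smooth_lincomb[of A W f "\<lambda>_. 0" \<omega> \<omega>] smooth_fun_const[of A W 0]
  by (simp add: form_mult_def)

lemma one_form_cong:
  assumes A: "smooth_atlas A" "open W" and eq: "\<And>p. p \<in> W \<Longrightarrow> \<omega> p = \<eta> p" and \<omega>: "one_form A W \<omega>"
  shows "one_form A W \<eta>"
  unfolding one_form_def
proof (intro conjI ballI allI)
  show "\<eta> p \<in> cotangent_space A p" if "p \<in> W" for p
    using one_form_cotangent[OF \<omega> that] eq[OF that] by simp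
  fix c u assume c: "c \<in> A"
  have "open (W \<inter> fst c)" using A c smooth_atlas_open_domain by blast
  then show "smooth_fun A (W \<inter> fst c) (\<lambda>p. \<eta> p (coord_vec A c u p))"
    by (rule smooth_fun_cong[OF A(1), where f = "\<lambda>p. \<omega> p (coord_vec A c u p)"])
      (use eq \<omega> c in \<open>auto simp: one_form_def\<close>)
qed

text \<open>
  In a product chart the coefficients of a lift are those of the one-form, composed with a projection.
\<close>

lemma one_form_lifts:
  fixes A :: "('a::{t2_space, second_countable_topology}, 'e::euclidean_space) atlas"
    and B :: "('b::{t2_space, second_countable_topology}, 'f::euclidean_space) atlas"
  assumes A: "smooth_atlas A" and B: "smooth_atlas B" and U: "open U" and V: "open V"
  shows "one_form A U \<omega> \<Longrightarrow> one_form (prod_atlas A B) (U \<times> V) (hlift A B \<omega>)"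
    and "one_form B V \<eta> \<Longrightarrow> one_form (prod_atlas A B) (U \<times> V) (vlift A B \<eta>)"
proof -
  let ?AB = "prod_atlas A B"
  note AB = smooth_atlas_prod[OF A B]
  note push = pushforward_in_tangent_space[OF A B]
  have op: "open (U \<inter> fst c)" "open (V \<inter> fst d)" if "c \<in> A" "d \<in> B" for c d
    using U V that smooth_atlas_open_domain A B by blast+
  have coords: "hlift A B \<omega> x (coord_vec ?AB (prod_chart c d) u x) =
      \<omega> (fst x) (coord_vec A c (fst u) (fst x))"
    "vlift A B \<eta> x (coord_vec ?AB (prod_chart c d) u x) = \<eta> (snd x) (coord_vec B d (snd u) (snd x))"
    if "c \<in> A" "d \<in> B" "fst x \<in> fst c" "snd x \<in> fst d" for c d u x
  proof -
    have "coord_vec ?AB (prod_chart c d) u x \<in> tangent_space ?AB x"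
      using that
      by (intro coord_vec_in_tangent_space)
        (auto simp: prod_chart_in_prod_atlas fst_prod_chart mem_Times_iff)
    then show "hlift A B \<omega> x (coord_vec ?AB (prod_chart c d) u x) =
        \<omega> (fst x) (coord_vec A c (fst u) (fst x))"
      "vlift A B \<eta> x (coord_vec ?AB (prod_chart c d) u x) = \<eta> (snd x) (coord_vec B d (snd u) (snd x))"
      using pushforward_coord_vec[OF A B that(1,3,2,4), of "fst u" "snd u"]
      by (simp_all add: hlift_def vlift_def pullback_covec_def)
  qed
  show "one_form ?AB (U \<times> V) (hlift A B \<omega>)" if \<omega>: "one_form A U \<omega>"
    unfolding one_form_def
  proof (intro conjI ballI allI)
    show "hlift A B \<omega> x \<in> cotangent_space ?AB x" if "x \<in> U \<times> V" for x
      unfolding hlift_def using that one_form_cotangent[OF \<omega>]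
      by (intro pullback_covec_in_cotangent_space[OF AB push(1)]) auto
    fix C and u :: "'e \<times> 'f" assume "C \<in> ?AB"
    then obtain c d where C: "C = prod_chart c d" "c \<in> A" "d \<in> B" by (rule prod_atlas_cases)
    let ?S = "(U \<inter> fst c) \<times> (V \<inter> fst d)"
    have S: "U \<times> V \<inter> fst C = ?S" by (simp add: C(1) fst_prod_chart Times_Int_Times)
    have "smooth_fun A (U \<inter> fst c) (\<lambda>p. \<omega> p (coord_vec A c (fst u) p))"
      using \<omega> C unfolding one_form_def by blast
    from smooth_fun_Times(1)[OF A B op[OF C(2,3)] this]
    show "smooth_fun ?AB (U \<times> V \<inter> fst C) (\<lambda>x. hlift A B \<omega> x (coord_vec ?AB C u x))"
      unfolding S
      by (rule smooth_fun_cong[OF AB open_Times[OF op[OF C(2,3)]], rotated])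
        (use coords(1)[OF C(2,3), where u = u] in \<open>auto simp: C(1)\<close>)
  qed
  show "one_form ?AB (U \<times> V) (vlift A B \<eta>)" if \<eta>: "one_form B V \<eta>"
    unfolding one_form_def
  proof (intro conjI ballI allI)
    show "vlift A B \<eta> x \<in> cotangent_space ?AB x" if "x \<in> U \<times> V" for x
      unfolding vlift_def using that one_form_cotangent[OF \<eta>]
      by (intro pullback_covec_in_cotangent_space[OF AB push(2)]) auto
    fix C and u :: "'e \<times> 'f" assume "C \<in> ?AB"
    then obtain c d where C: "C = prod_chart c d" "c \<in> A" "d \<in> B" by (rule prod_atlas_cases)
    let ?S = "(U \<inter> fst c) \<times> (V \<inter> fst d)"
    have S: "U \<times> V \<inter> fst C = ?S" by (simp add: C(1) fst_prod_chart Times_Int_Times)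
    have "smooth_fun B (V \<inter> fst d) (\<lambda>p. \<eta> p (coord_vec B d (snd u) p))"
      using \<eta> C unfolding one_form_def by blast
    from smooth_fun_Times(2)[OF A B op[OF C(2,3)] this]
    show "smooth_fun ?AB (U \<times> V \<inter> fst C) (\<lambda>x. vlift A B \<eta> x (coord_vec ?AB C u x))"
      unfolding S
      by (rule smooth_fun_cong[OF AB open_Times[OF op[OF C(2,3)]], rotated])
        (use coords(2)[OF C(2,3), where u = u] in \<open>auto simp: C(1)\<close>)
  qed
qed


section \<open>Curvature of a contravariant Levi-Civita connection\<close>

text \<open>
  An orthonormal coframe may exist only locally, so everything takes place over a fixed open set \<open>W\<close>. The
  one-forms are total functions with arbitrary values off \<open>W\<close>; hence the care about locality.
\<close>

locale local_levi_civita =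
  fixes A :: "('a::{t2_space, second_countable_topology}, 'e::euclidean_space) atlas"
    and g :: "'a tmetric" and P :: "'a cotensor" and D :: "'a form \<Rightarrow> 'a form \<Rightarrow> 'a form"
    and W :: "'a set"
  assumes atlas: "smooth_atlas A" and scalar_product: "\<And>p. p \<in> W \<Longrightarrow> scalar_product_at A g p"
    and levi_civita: "levi_civita A (cometric A g) P D" and open_W: "open W"
begin

abbreviation gt where "gt \<equiv> cometric A g"
abbreviation form where "form \<omega> \<equiv> one_form A W \<omega>"

lemmas form_lincombI = one_form_lincomb[OF atlas open_W]

lemmas connection_axioms =
  levi_civita[unfolded levi_civita_def contravariant_connection_def, THEN conjunct1, THEN spec,
    THEN mp, OF open_W]

lemmas levi_civita_axioms =
  levi_civita[unfolded levi_civita_def, THEN conjunct2, THEN spec, THEN mp, OF open_W]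

lemma D_form: "form \<omega> \<Longrightarrow> form \<eta> \<Longrightarrow> form (D \<omega> \<eta>)"
  using connection_axioms[THEN conjunct1] by blast

lemma D_add:
  assumes "form \<omega>" "form \<eta>" "form \<gamma>" "p \<in> W"
  shows "D (form_add \<omega> \<eta>) \<gamma> p = form_add (D \<omega> \<gamma>) (D \<eta> \<gamma>) p"
    "D \<omega> (form_add \<eta> \<gamma>) p = form_add (D \<omega> \<eta>) (D \<omega> \<gamma>) p"
  using connection_axioms[THEN conjunct2, THEN conjunct1] assms by simp_all

lemma D_mult:
  assumes "form \<omega>" "form \<eta>" "smooth_fun A W f" "p \<in> W"
  shows "D (form_mult f \<omega>) \<eta> p = form_mult f (D \<omega> \<eta>) p"
    "D \<omega> (form_mult f \<eta>) p =
      form_add (form_mult f (D \<omega> \<eta>)) (form_mult (\<lambda>x. sharp A P \<omega> x f) \<eta>) p"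
  using connection_axioms[THEN conjunct2, THEN conjunct2, THEN conjunct2] assms by simp_all

lemma D_scale:
  assumes "form \<omega>" "form \<eta>" "p \<in> W"
  shows "D (form_mult (\<lambda>_. r) \<omega>) \<eta> p = form_mult (\<lambda>_. r) (D \<omega> \<eta>) p"
    "D \<omega> (form_mult (\<lambda>_. r) \<eta>) p = form_mult (\<lambda>_. r) (D \<omega> \<eta>) p"
  using connection_axioms[THEN conjunct2, THEN conjunct2, THEN conjunct1] assms by simp_all

lemma D_metric:
  assumes "form \<omega>" "form \<eta>" "form \<gamma>" "p \<in> W"
  shows "sharp A P \<omega> p (\<lambda>x. gt x (\<eta> x) (\<gamma> x)) = gt p (D \<omega> \<eta> p) (\<gamma> p) + gt p (\<eta> p) (D \<omega> \<gamma> p)"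
  using levi_civita_axioms[THEN conjunct2] assms by simp

lemma bracket_eq:
  assumes "form \<omega>" "form \<eta>" "p \<in> W"
  shows "form_bracket A P \<omega> \<eta> p = form_lincomb 1 (D \<omega> \<eta>) (- 1) (D \<eta> \<omega>) p"
proof -
  have "form_diff (D \<omega> \<eta>) (D \<eta> \<omega>) p = form_bracket A P \<omega> \<eta> p"
    using levi_civita_axioms[THEN conjunct1] assms by simp
  then show ?thesis by (simp add: form_diff_def form_lincomb_def)
qed

lemma D_lincomb:
  assumes "form \<omega>" "form \<eta>" "form \<gamma>" "p \<in> W"
  shows "D (form_lincomb a \<omega> b \<eta>) \<gamma> p = form_lincomb a (D \<omega> \<gamma>) b (D \<eta> \<gamma>) p"
    "D \<gamma> (form_lincomb a \<omega> b \<eta>) p = form_lincomb a (D \<gamma> \<omega>) b (D \<gamma> \<eta>) p"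
proof -
  have eq: "form_lincomb a \<omega> b \<eta> = form_add (form_mult (\<lambda>_. a) \<omega>) (form_mult (\<lambda>_. b) \<eta>)"
    by (simp add: form_lincomb_def form_add_def form_mult_def)
  have forms: "form (form_mult (\<lambda>_. a) \<omega>)" "form (form_mult (\<lambda>_. b) \<eta>)"
    using assms one_form_mult[OF atlas open_W smooth_fun_const[OF atlas open_W]] by blast+
  show "D (form_lincomb a \<omega> b \<eta>) \<gamma> p = form_lincomb a (D \<omega> \<gamma>) b (D \<eta> \<gamma>) p"
    unfolding eq D_add(1)[OF forms assms(3,4)] using D_scale(1) assms
    by (simp add: form_lincomb_def form_add_def form_mult_def)
  show "D \<gamma> (form_lincomb a \<omega> b \<eta>) p = form_lincomb a (D \<gamma> \<omega>) b (D \<gamma> \<eta>) p"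
    unfolding eq D_add(2)[OF assms(3) forms assms(4)] using D_scale(2) assms
    by (simp add: form_lincomb_def form_add_def form_mult_def)
qed

text \<open>
  If \<open>\<delta>\<close> vanishes on \<open>W\<close>, then \<open>\<delta> = f \<delta>\<close> everywhere for the function \<open>f\<close> that is \<open>0\<close> on \<open>W\<close> and \<open>1\<close>
  elsewhere. On \<open>W\<close> this \<open>f\<close> is constant, hence smooth, so \<open>f\<close>-linearity in the first argument and
  the Leibniz rule in the second give \<open>0\<close>. Locality of \<open>D\<close> follows.
\<close>

lemma D_vanishing:
  assumes "form \<delta>" "\<And>x. x \<in> W \<Longrightarrow> \<delta> x = (\<lambda>_. 0)" "form \<eta>" "p \<in> W"
  shows "D \<delta> \<eta> p = (\<lambda>_. 0)" "D \<eta> \<delta> p = (\<lambda>_. 0)"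
proof -
  let ?f = "\<lambda>x. if x \<in> W then 0 else 1"
  have f: "smooth_fun A W ?f"
    by (rule smooth_fun_cong[OF atlas open_W _ smooth_fun_const[OF atlas open_W, of 0]]) simp
  have eq: "form_mult ?f \<delta> = \<delta>" using assms(2) by (auto simp: form_mult_def fun_eq_iff)
  show "D \<delta> \<eta> p = (\<lambda>_. 0)"
    using D_mult(1)[OF assms(1,3) f assms(4)] assms(4) unfolding eq by (simp add: form_mult_def)
  show "D \<eta> \<delta> p = (\<lambda>_. 0)"
    using D_mult(2)[OF assms(3,1) f assms(4)] assms(2,4) unfolding eq
    by (simp add: form_mult_def form_add_def)
qed

lemma D_cong:
  assumes forms: "form \<omega>" "form \<omega>'" "form \<eta>" "form \<eta>'"
    and eq: "\<And>x. x \<in> W \<Longrightarrow> \<omega> x = \<omega>' x" "\<And>x. x \<in> W \<Longrightarrow> \<eta> x = \<eta>' x" and p: "p \<in> W"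
  shows "D \<omega> \<eta> p = D \<omega>' \<eta>' p"
proof -
  have "D (form_lincomb 1 \<omega> (- 1) \<omega>') \<eta> p = (\<lambda>_. 0)"
    by (rule D_vanishing(1)[OF form_lincombI]) (use forms eq p in \<open>auto simp: form_lincomb_def\<close>)
  then have "D \<omega> \<eta> p = D \<omega>' \<eta> p"
    using D_lincomb(1)[OF forms(1-3) p, of 1 "- 1"] by (simp add: form_lincomb_def fun_eq_iff)
  moreover have "D \<omega>' (form_lincomb 1 \<eta> (- 1) \<eta>') p = (\<lambda>_. 0)"
    by (rule D_vanishing(2)[OF form_lincombI]) (use forms eq p in \<open>auto simp: form_lincomb_def\<close>)
  then have "D \<omega>' \<eta> p = D \<omega>' \<eta>' p"
    using D_lincomb(2)[OF forms(3,4,2) p, of 1 "- 1"] by (simp add: form_lincomb_def fun_eq_iff)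
  ultimately show ?thesis by simp
qed

lemma bracket_form: "form \<omega> \<Longrightarrow> form \<eta> \<Longrightarrow> form (form_bracket A P \<omega> \<eta>)"
  using one_form_cong[OF atlas open_W _ form_lincombI[OF D_form D_form]] bracket_eq by metis

lemma gt_lincomb:
  assumes "form \<omega>" "form \<eta>" "form \<gamma>" "p \<in> W"
  shows "gt p (form_lincomb a \<omega> b \<eta> p) (\<gamma> p) = a * gt p (\<omega> p) (\<gamma> p) + b * gt p (\<eta> p) (\<gamma> p)"
    "gt p (\<gamma> p) (form_lincomb a \<omega> b \<eta> p) = a * gt p (\<gamma> p) (\<omega> p) + b * gt p (\<gamma> p) (\<eta> p)"
  unfolding form_lincomb_def
  by (rule cometric_lincomb[OF atlas scalar_product[OF assms(4)]];
      rule one_form_cotangent[OF _ assms(4)]; fact)+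

lemma gt_sym: "form \<omega> \<Longrightarrow> form \<eta> \<Longrightarrow> p \<in> W \<Longrightarrow> gt p (\<omega> p) (\<eta> p) = gt p (\<eta> p) (\<omega> p)"
  using cometric_sym[OF atlas scalar_product] one_form_cotangent by blast

text \<open>
  On \<open>W\<close> the one-forms \<open>F \<zeta>\<close> and \<open>r \<zeta>\<close> agree, so \<open>D\<close> agrees on them by locality; comparing the Leibniz
  rule for the first with homogeneity for the second leaves \<open>\<sharp>\<omega>(F) \<zeta> = 0\<close>, and
  \<open>\<zeta>\<close> does not vanish at \<open>p\<close>.
\<close>

lemma sharp_locally_const:
  assumes forms: "form \<omega>" "form \<zeta>" and p: "p \<in> W" "\<zeta> p \<noteq> (\<lambda>_. 0)"
    and F: "\<And>x. x \<in> W \<Longrightarrow> F x = r"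
  shows "sharp A P \<omega> p F = 0"
proof -
  have F_smooth: "smooth_fun A W F"
    by (rule smooth_fun_cong[OF atlas open_W _ smooth_fun_const[OF atlas open_W, of r]]) (simp add: F)
  have "form (form_mult F \<zeta>)" "form (form_mult (\<lambda>_. r) \<zeta>)"
    using one_form_mult[OF atlas open_W] F_smooth smooth_fun_const[OF atlas open_W] forms by blast+
  then have "D \<omega> (form_mult F \<zeta>) p = D \<omega> (form_mult (\<lambda>_. r) \<zeta>) p"
    using forms p F by (intro D_cong) (auto simp: form_mult_def)
  then have "form_add (form_mult F (D \<omega> \<zeta>)) (form_mult (\<lambda>x. sharp A P \<omega> x F) \<zeta>) p =
      form_mult (\<lambda>_. r) (D \<omega> \<zeta>) p"
    using D_mult(2)[OF forms F_smooth p(1)] D_scale(2)[OF forms p(1), of r] by simp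
  then show ?thesis using p(2) F[OF p(1)] by (auto simp: form_mult_def form_add_def fun_eq_iff)
qed

context
  fixes \<gamma> \<delta> \<zeta> :: "'a form" and r :: real
  assumes \<gamma>: "form \<gamma>" and \<delta>: "form \<delta>" and const: "\<And>x. x \<in> W \<Longrightarrow> gt x (\<gamma> x) (\<delta> x) = r"
    and \<zeta>: "form \<zeta>" "\<And>x. x \<in> W \<Longrightarrow> \<zeta> x \<noteq> (\<lambda>_. 0)"
begin

lemma D_skew:
  assumes "form \<omega>" "p \<in> W"
  shows "gt p (D \<omega> \<gamma> p) (\<delta> p) + gt p (\<gamma> p) (D \<omega> \<delta> p) = 0"
  unfolding D_metric[OF assms(1) \<gamma> \<delta> assms(2), symmetric]
  by (rule sharp_locally_const[OF assms(1) \<zeta>(1) assms(2) \<zeta>(2)[OF assms(2)]]) (rule const)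

text \<open>
  The identity \<open>D_skew\<close> for \<open>\<eta>\<close> differentiated in the direction \<open>\<sharp>\<omega>\<close>.
\<close>

lemma D_D_skew:
  assumes \<omega>: "form \<omega>" and \<eta>: "form \<eta>" and p: "p \<in> W"
  shows "gt p (D \<omega> (D \<eta> \<gamma>) p) (\<delta> p) + gt p (D \<eta> \<gamma> p) (D \<omega> \<delta> p) +
    gt p (D \<omega> \<gamma> p) (D \<eta> \<delta> p) + gt p (\<gamma> p) (D \<omega> (D \<eta> \<delta>) p) = 0"
proof -
  \<comment> \<open>The functions \<open>gt (D \<eta> \<gamma>) \<delta>\<close> and \<open>gt (- \<gamma>) (D \<eta> \<delta>)\<close> agree on \<open>W\<close>. Setting all one-forms to
    \<open>0\<close> off \<open>W\<close> makes the functions equal, so that \<open>\<sharp>\<omega>\<close> takes the same value on them.\<close>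
  define on_W :: "'a form \<Rightarrow> 'a form" where "on_W \<beta> = (\<lambda>x. if x \<in> W then \<beta> x else (\<lambda>_. 0))" for \<beta>
  have on_W: "form (on_W \<beta>)" "D \<omega> (on_W \<beta>) p = D \<omega> \<beta> p" "on_W \<beta> p = \<beta> p" if "form \<beta>" for \<beta>
  proof -
    show f: "form (on_W \<beta>)"
      by (rule one_form_cong[OF atlas open_W _ that]) (simp add: on_W_def)
    show "D \<omega> (on_W \<beta>) p = D \<omega> \<beta> p"
      by (rule D_cong[OF \<omega> \<omega> f that]) (use p in \<open>auto simp: on_W_def\<close>)
    show "on_W \<beta> p = \<beta> p" using p by (simp add: on_W_def)
  qed
  let ?m = "form_lincomb (- 1) \<gamma> 0 \<gamma>"
  have m: "form ?m" using form_lincombI[OF \<gamma> \<gamma>] .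
  note forms = D_form[OF \<eta> \<gamma>] D_form[OF \<eta> \<delta>]
  have "gt x (on_W (D \<eta> \<gamma>) x) (on_W \<delta> x) = gt x (on_W ?m x) (on_W (D \<eta> \<delta>) x)" for x
    using D_skew[OF \<eta>, of x] gt_lincomb(1)[OF \<gamma> \<gamma> forms(2), of x "- 1" 0] by (auto simp: on_W_def)
  then have "sharp A P \<omega> p (\<lambda>x. gt x (on_W (D \<eta> \<gamma>) x) (on_W \<delta> x)) =
      sharp A P \<omega> p (\<lambda>x. gt x (on_W ?m x) (on_W (D \<eta> \<delta>) x))" by simp
  then have "gt p (D \<omega> (D \<eta> \<gamma>) p) (\<delta> p) + gt p (D \<eta> \<gamma> p) (D \<omega> \<delta> p) =
      gt p (D \<omega> ?m p) (D \<eta> \<delta> p) + gt p (?m p) (D \<omega> (D \<eta> \<delta>) p)"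
    unfolding D_metric[OF \<omega> on_W(1)[OF forms(1)] on_W(1)[OF \<delta>] p]
      D_metric[OF \<omega> on_W(1)[OF m] on_W(1)[OF forms(2)] p]
    using on_W(2,3) forms m \<delta> by simp
  then show ?thesis
    using gt_lincomb(1)[OF \<gamma> \<gamma> D_form[OF \<omega> forms(2)] p, of "- 1" 0]
      gt_lincomb(1)[OF D_form[OF \<omega> \<gamma>] D_form[OF \<omega> \<gamma>] forms(2) p, of "- 1" 0]
      D_lincomb(2)[OF \<gamma> \<gamma> \<omega> p, of "- 1" 0] by simp
qed

end

lemma curvature_lincomb:
  "curvature A P D \<omega> \<eta> \<gamma> = form_lincomb 1
    (form_lincomb 1 (D \<omega> (D \<eta> \<gamma>)) (- 1) (D \<eta> (D \<omega> \<gamma>))) (- 1) (D (form_bracket A P \<omega> \<eta>) \<gamma>)"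
  by (simp add: curvature_def form_diff_def form_lincomb_def)

lemma curvature_form: "form \<omega> \<Longrightarrow> form \<eta> \<Longrightarrow> form \<gamma> \<Longrightarrow> form (curvature A P D \<omega> \<eta> \<gamma>)"
  unfolding curvature_lincomb by (intro form_lincombI D_form bracket_form)

text \<open>
  For any \<open>\<gamma>\<close> and \<open>\<delta>\<close> the left-hand side is \<open>[\<sharp>\<omega>, \<sharp>\<eta>] - \<sharp>[\<omega>, \<eta>]\<close> applied to the function \<open>gt \<gamma> \<delta>\<close>,
  and that function is constant here. Formally: antisymmetrising \<open>D_D_skew\<close> in \<open>\<omega>\<close> and \<open>\<eta>\<close> removes the
  products of first derivatives, which are symmetric, and \<open>D_skew\<close> disposes of the bracket term.
\<close>

lemma curvature_skew_metric:
  assumes \<gamma>: "form \<gamma>" and \<delta>: "form \<delta>" and const: "\<And>x. x \<in> W \<Longrightarrow> gt x (\<gamma> x) (\<delta> x) = r"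
    and \<zeta>: "form \<zeta>" "\<And>x. x \<in> W \<Longrightarrow> \<zeta> x \<noteq> (\<lambda>_. 0)"
    and \<omega>: "form \<omega>" and \<eta>: "form \<eta>" and p: "p \<in> W"
  shows "gt p (curvature A P D \<omega> \<eta> \<gamma> p) (\<delta> p) + gt p (\<gamma> p) (curvature A P D \<omega> \<eta> \<delta> p) = 0"
proof -
  let ?Z = "\<lambda>\<beta>. D (form_bracket A P \<omega> \<eta>) \<beta>"
  have b: "form (form_bracket A P \<omega> \<eta>)" using bracket_form[OF \<omega> \<eta>] .
  have f: "form (D \<omega> (D \<eta> \<beta>))" "form (D \<eta> (D \<omega> \<beta>))" "form (?Z \<beta>)" if "form \<beta>" for \<beta>
    by (intro D_form \<omega> \<eta> b that)+
  note lin = gt_lincomb[OF form_lincombI[OF f(1,2)] f(3) _ p, where a = 1 and b = "- 1"]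
    gt_lincomb[OF f(1,2) _ p, where a = 1 and b = "- 1"]
  have "gt p (curvature A P D \<omega> \<eta> \<gamma> p) (\<delta> p) = gt p (D \<omega> (D \<eta> \<gamma>) p) (\<delta> p)
      - gt p (D \<eta> (D \<omega> \<gamma>) p) (\<delta> p) - gt p (?Z \<gamma> p) (\<delta> p)"
    unfolding curvature_lincomb
    by (simp only: lin(1)[OF \<gamma> \<gamma> \<gamma> \<delta>] lin(3)[OF \<gamma> \<gamma> \<delta>]) simp
  moreover have "gt p (\<gamma> p) (curvature A P D \<omega> \<eta> \<delta> p) = gt p (\<gamma> p) (D \<omega> (D \<eta> \<delta>) p)
      - gt p (\<gamma> p) (D \<eta> (D \<omega> \<delta>) p) - gt p (\<gamma> p) (?Z \<delta> p)"
    unfolding curvature_lincomb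
    by (simp only: lin(2)[OF \<delta> \<delta> \<delta> \<gamma>] lin(4)[OF \<delta> \<delta> \<gamma>]) simp
  moreover note D_D_skew[OF \<gamma> \<delta> const \<zeta> \<omega> \<eta> p] D_D_skew[OF \<gamma> \<delta> const \<zeta> \<eta> \<omega> p]
    D_skew[OF \<gamma> \<delta> const \<zeta> b p]
  ultimately show ?thesis by linarith
qed

lemma curvature_antisym:
  assumes "form \<omega>" "form \<eta>" "form \<gamma>" "p \<in> W"
  shows "curvature A P D \<omega> \<eta> \<gamma> p v = - curvature A P D \<eta> \<omega> \<gamma> p v"
proof -
  note b = bracket_form[OF assms(1,2)] bracket_form[OF assms(2,1)]
  have "D (form_bracket A P \<eta> \<omega>) \<gamma> p =
      D (form_lincomb (- 1) (form_bracket A P \<omega> \<eta>) 0 (form_bracket A P \<omega> \<eta>)) \<gamma> p"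
  proof (rule D_cong[OF b(2) form_lincombI[OF b(1,1)] assms(3,3) _ refl assms(4)])
    show "form_bracket A P \<eta> \<omega> x =
        form_lincomb (- 1) (form_bracket A P \<omega> \<eta>) 0 (form_bracket A P \<omega> \<eta>) x" if "x \<in> W" for x
      using bracket_eq[OF assms(1,2) that] bracket_eq[OF assms(2,1) that]
      by (simp add: form_lincomb_def fun_eq_iff)
  qed
  also have "\<dots> = form_lincomb (- 1) (D (form_bracket A P \<omega> \<eta>) \<gamma>) 0 (D (form_bracket A P \<omega> \<eta>) \<gamma>) p"
    by (rule D_lincomb(1)[OF b(1,1) assms(3,4)])
  finally have "D (form_bracket A P \<eta> \<omega>) \<gamma> p v = - D (form_bracket A P \<omega> \<eta>) \<gamma> p v"
    by (simp add: form_lincomb_def)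
  then show ?thesis by (simp add: curvature_def form_diff_def)
qed

lemma curvature_lincomb_left:
  assumes forms: "form \<omega>" "form \<omega>'" "form \<eta>" "form \<gamma>" and p: "p \<in> W"
  shows "curvature A P D (form_lincomb a \<omega> b \<omega>') \<eta> \<gamma> p v =
    a * curvature A P D \<omega> \<eta> \<gamma> p v + b * curvature A P D \<omega>' \<eta> \<gamma> p v"
proof -
  let ?l = "form_lincomb a \<omega> b \<omega>'"
  let ?B = "form_bracket A P"
  have l: "form ?l" using form_lincombI[OF forms(1,2)] .
  have 1: "D ?l (D \<eta> \<gamma>) p = form_lincomb a (D \<omega> (D \<eta> \<gamma>)) b (D \<omega>' (D \<eta> \<gamma>)) p"
    using D_lincomb(1)[OF forms(1,2) D_form[OF forms(3,4)] p] .
  have "D \<eta> (D ?l \<gamma>) p = D \<eta> (form_lincomb a (D \<omega> \<gamma>) b (D \<omega>' \<gamma>)) p"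
    by (rule D_cong[OF forms(3,3) _ _ refl _ p]) (intro D_form form_lincombI D_lincomb(1) l forms | assumption)+
  also have "\<dots> = form_lincomb a (D \<eta> (D \<omega> \<gamma>)) b (D \<eta> (D \<omega>' \<gamma>)) p"
    by (intro D_lincomb(2) D_form forms p)
  finally have 2: "D \<eta> (D ?l \<gamma>) p = form_lincomb a (D \<eta> (D \<omega> \<gamma>)) b (D \<eta> (D \<omega>' \<gamma>)) p" .
  have "?B ?l \<eta> x = form_lincomb a (?B \<omega> \<eta>) b (?B \<omega>' \<eta>) x" if "x \<in> W" for x
  proof
    fix v
    have "D ?l \<eta> x v = a * D \<omega> \<eta> x v + b * D \<omega>' \<eta> x v" "D \<eta> ?l x v = a * D \<eta> \<omega> x v + b * D \<eta> \<omega>' x v"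
      using D_lincomb[OF forms(1-3) that, of a b] by (simp_all add: form_lincomb_def)
    then show "?B ?l \<eta> x v = form_lincomb a (?B \<omega> \<eta>) b (?B \<omega>' \<eta>) x v"
      unfolding bracket_eq[OF l forms(3) that] form_lincomb_def[of a "?B \<omega> \<eta>"]
        bracket_eq[OF forms(1,3) that] bracket_eq[OF forms(2,3) that]
      by (simp add: form_lincomb_def[of 1] algebra_simps)
  qed
  then have "D (?B ?l \<eta>) \<gamma> p = D (form_lincomb a (?B \<omega> \<eta>) b (?B \<omega>' \<eta>)) \<gamma> p"
    by (intro D_cong[OF _ _ forms(4,4) _ refl p] bracket_form form_lincombI l forms)
  also have "\<dots> = form_lincomb a (D (?B \<omega> \<eta>) \<gamma>) b (D (?B \<omega>' \<eta>) \<gamma>) p"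
    by (intro D_lincomb(1) bracket_form forms p)
  finally have 3: "D (?B ?l \<eta>) \<gamma> p = form_lincomb a (D (?B \<omega> \<eta>) \<gamma>) b (D (?B \<omega>' \<eta>) \<gamma>) p" .
  show ?thesis
    unfolding curvature_def form_diff_def 1 2 3 by (simp add: form_lincomb_def algebra_simps)
qed

lemma curvature_lincomb_arg:
  assumes forms: "form \<omega>" "form \<eta>" "form \<gamma>" "form \<gamma>'" and p: "p \<in> W"
  shows "curvature A P D \<omega> \<eta> (form_lincomb a \<gamma> b \<gamma>') p v =
    a * curvature A P D \<omega> \<eta> \<gamma> p v + b * curvature A P D \<omega> \<eta> \<gamma>' p v"
proof -
  let ?l = "form_lincomb a \<gamma> b \<gamma>'"
  have l: "form ?l" using form_lincombI[OF forms(3,4)] .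
  have "D \<alpha> (D \<beta> ?l) p = form_lincomb a (D \<alpha> (D \<beta> \<gamma>)) b (D \<alpha> (D \<beta> \<gamma>')) p"
    if "form \<alpha>" "form \<beta>" for \<alpha> \<beta>
  proof -
    have "D \<alpha> (D \<beta> ?l) p = D \<alpha> (form_lincomb a (D \<beta> \<gamma>) b (D \<beta> \<gamma>')) p"
      by (rule D_cong[OF that(1,1) _ _ refl _ p])
        (intro D_form form_lincombI D_lincomb(2) l forms that | assumption)+
    also have "\<dots> = form_lincomb a (D \<alpha> (D \<beta> \<gamma>)) b (D \<alpha> (D \<beta> \<gamma>')) p"
      by (intro D_lincomb(2) D_form forms p that)
    finally show ?thesis .
  qed
  note second = this[OF forms(1,2)] this[OF forms(2,1)]
  have first: "D (form_bracket A P \<omega> \<eta>) ?l p =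
      form_lincomb a (D (form_bracket A P \<omega> \<eta>) \<gamma>) b (D (form_bracket A P \<omega> \<eta>) \<gamma>') p"
    by (intro D_lincomb(2) bracket_form forms p)
  show ?thesis
    unfolding curvature_def form_diff_def first second by (simp add: form_lincomb_def algebra_simps)
qed

lemma curvature_plane:
  assumes forms: "form \<tau>" "form \<sigma>" "form \<gamma>" and p: "p \<in> W"
  shows "curvature A P D (form_lincomb a \<tau> b \<sigma>) (form_lincomb c \<tau> d \<sigma>) \<gamma> p v =
    (a * d - b * c) * curvature A P D \<tau> \<sigma> \<gamma> p v"
proof -
  let ?R = "\<lambda>\<omega> \<eta>. curvature A P D \<omega> \<eta> \<gamma> p v"
  let ?l = "form_lincomb c \<tau> d \<sigma>"
  have l: "form ?l" using form_lincombI[OF forms(1,2)] .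
  have diag: "?R \<beta> \<beta> = 0" if "form \<beta>" for \<beta>
    using curvature_antisym[OF that that forms(3) p, of v] by simp
  have right: "?R \<beta> ?l = c * ?R \<beta> \<tau> + d * ?R \<beta> \<sigma>" if "form \<beta>" for \<beta>
    using curvature_antisym[OF that l forms(3) p, of v]
      curvature_antisym[OF forms(1) that forms(3) p, of v]
      curvature_antisym[OF forms(2) that forms(3) p, of v]
      curvature_lincomb_left[OF forms(1,2) that forms(3) p, of c d v]
    by simp
  have "?R (form_lincomb a \<tau> b \<sigma>) ?l = a * ?R \<tau> ?l + b * ?R \<sigma> ?l"
    using curvature_lincomb_left[OF forms(1,2) l forms(3) p] .
  then show ?thesis
    using right[OF forms(1)] right[OF forms(2)] diag[OF forms(1)] diag[OF forms(2)]
      curvature_antisym[OF forms(2,1,3) p, of v] by (simp add: algebra_simps)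
qed

text \<open>
  Numerator and denominator both acquire the factor \<open>(a d - b c)\<^sup>2\<close>. In the numerator one factor comes
  from the antisymmetry of \<open>R(\<omega>, \<eta>)\<close> in \<open>\<omega>\<close> and \<open>\<eta>\<close>, the other from \<open>R(\<tau>, \<sigma>)\<close> being
  skew-adjoint on the plane, which is where the constant Gram matrix enters.
\<close>

lemma sectional_curvature_change_basis:
  assumes \<tau>: "form \<tau>" and \<sigma>: "form \<sigma>"
    and gram: "\<And>x. x \<in> W \<Longrightarrow> gt x (\<tau> x) (\<tau> x) = E" "\<And>x. x \<in> W \<Longrightarrow> gt x (\<tau> x) (\<sigma> x) = F"
      "\<And>x. x \<in> W \<Longrightarrow> gt x (\<sigma> x) (\<sigma> x) = G"
    and nondeg: "E * G - F\<^sup>2 \<noteq> 0" and det: "a * d - b * c \<noteq> 0" and p: "p \<in> W"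
  shows "sectional_curvature A gt P D (form_lincomb a \<tau> b \<sigma>) (form_lincomb c \<tau> d \<sigma>) p =
    sectional_curvature A gt P D \<tau> \<sigma> p"
proof -
  let ?x = "form_lincomb a \<tau> b \<sigma>" and ?y = "form_lincomb c \<tau> d \<sigma>"
  let ?R = "\<lambda>\<gamma>. curvature A P D \<tau> \<sigma> \<gamma>"
  let ?k = "a * d - b * c"
  have x: "form ?x" and y: "form ?y" using form_lincombI \<tau> \<sigma> by blast+
  have nz: "\<tau> z \<noteq> (\<lambda>_. 0)" if "z \<in> W" for z
    using cometric_zero_left[OF atlas scalar_product[OF that]] one_form_cotangent[OF \<tau> that]
      one_form_cotangent[OF \<sigma> that] gram[OF that] nondeg by (metis diff_self mult_zero_left power2_eq_square)
  have skew: "gt p (?R \<gamma> p) (\<delta> p) + gt p (\<gamma> p) (?R \<delta> p) = 0"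
    if "form \<gamma>" "form \<delta>" "\<And>x. x \<in> W \<Longrightarrow> gt x (\<gamma> x) (\<delta> x) = r" for \<gamma> \<delta> r
    using curvature_skew_metric[OF that \<tau> nz \<tau> \<sigma> p] .
  have R: "form (?R \<gamma>)" if "form \<gamma>" for \<gamma> using curvature_form[OF \<tau> \<sigma> that] .
  have tt: "gt p (?R \<tau> p) (\<tau> p) = 0"
    using skew[OF \<tau> \<tau> gram(1)] gt_sym[OF R[OF \<tau>] \<tau> p] by simp
  have ss: "gt p (?R \<sigma> p) (\<sigma> p) = 0"
    using skew[OF \<sigma> \<sigma> gram(3)] gt_sym[OF R[OF \<sigma>] \<sigma> p] by simp
  have ts: "gt p (?R \<tau> p) (\<sigma> p) = - gt p (?R \<sigma> p) (\<tau> p)"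
    using skew[OF \<tau> \<sigma> gram(2)] gt_sym[OF R[OF \<sigma>] \<tau> p] by simp
  have "curvature A P D ?x ?y ?y p = form_lincomb ?k (form_lincomb c (?R \<tau>) d (?R \<sigma>)) 0 (?R \<tau>) p"
    using curvature_plane[OF \<tau> \<sigma> y p] curvature_lincomb_arg[OF \<tau> \<sigma> \<tau> \<sigma> p]
    by (simp add: form_lincomb_def fun_eq_iff)
  then have num: "gt p (curvature A P D ?x ?y ?y p) (?x p) = ?k\<^sup>2 * gt p (?R \<sigma> p) (\<tau> p)"
    using gt_lincomb \<tau> \<sigma> R x form_lincombI p tt ss ts
    by (simp add: power2_eq_square algebra_simps)
  have st: "gt p (\<sigma> p) (\<tau> p) = F" using gt_sym[OF \<sigma> \<tau> p] gram(2)[OF p] by simp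
  have "gt p (?x p) (?x p) * gt p (?y p) (?y p) - (gt p (?x p) (?y p))\<^sup>2 = ?k\<^sup>2 * (E * G - F\<^sup>2)"
    using gt_lincomb \<tau> \<sigma> x y p gram[OF p] st by (simp add: power2_eq_square algebra_simps)
  then show ?thesis
    unfolding sectional_curvature_def num using det gram[OF p] by simp
qed

lemma null_form_eq:
  "null_form \<tau> \<sigma> = form_lincomb (1 / sqrt 2) \<tau> (1 / sqrt 2) \<sigma>"
  "null_form_bar \<tau> \<sigma> = form_lincomb (- (1 / sqrt 2)) \<tau> (1 / sqrt 2) \<sigma>"
  by (simp_all add: null_form_def null_form_bar_def form_lincomb_def form_mult_def form_add_def
      fun_eq_iff algebra_simps)

context
  fixes \<tau> \<sigma>
  assumes \<tau>: "form \<tau>" and \<sigma>: "form \<sigma>"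
    and gram: "\<And>x. x \<in> W \<Longrightarrow> gt x (\<tau> x) (\<tau> x) = - 1" "\<And>x. x \<in> W \<Longrightarrow> gt x (\<tau> x) (\<sigma> x) = 0"
      "\<And>x. x \<in> W \<Longrightarrow> gt x (\<sigma> x) (\<sigma> x) = 1"
begin

lemma sectional_curvature_null_forms:
  "p \<in> W \<Longrightarrow> sectional_curvature A gt P D (null_form \<tau> \<sigma>) (null_form_bar \<tau> \<sigma>) p =
    sectional_curvature A gt P D \<tau> \<sigma> p"
  unfolding null_form_eq by (rule sectional_curvature_change_basis[OF \<tau> \<sigma> gram]) auto

lemma null_pair_null_forms: "null_pair A gt W (null_form \<tau> \<sigma>) (null_form_bar \<tau> \<sigma>)"
proof -
  let ?x = "null_form \<tau> \<sigma>" and ?y = "null_form_bar \<tau> \<sigma>"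
  have x: "form ?x" and y: "form ?y" unfolding null_form_eq using form_lincombI \<tau> \<sigma> by blast+
  have gt: "gt p (?x p) (?x p) = 0 \<and> gt p (?y p) (?y p) = 0 \<and> gt p (?x p) (?y p) = 1" if p: "p \<in> W" for p
  proof -
    have "gt p (\<sigma> p) (\<tau> p) = 0" using gt_sym[OF \<sigma> \<tau> p] gram(2)[OF p] by simp
    then show ?thesis
      using x y gt_lincomb \<tau> \<sigma> p gram[OF p] unfolding null_form_eq by (simp add: algebra_simps)
  qed
  have "r = 0 \<and> s = 0" if p: "p \<in> W" and 0: "\<forall>v. r * ?x p v + s * ?y p v = 0" for p r s
  proof -
    have "form_lincomb r ?x s ?y p = (\<lambda>_. 0)" using 0 by (simp add: form_lincomb_def fun_eq_iff)
    then have "r * gt p (?x p) (\<beta> p) + s * gt p (?y p) (\<beta> p) = 0" if "form \<beta>" for \<beta>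
      using gt_lincomb(1)[OF x y that p, of r s]
        cometric_zero_left[OF atlas scalar_product[OF p] one_form_cotangent[OF that p]] by simp
    from this[OF x] this[OF y] show ?thesis using gt[OF p] gt_sym[OF y x p] by simp
  qed
  then show ?thesis using x y gt unfolding null_pair_def by blast
qed

end

end


section \<open>Qualar curvature as a sum over null planes\<close>

theorem proposition4p2:
  fixes A1 :: "('a::{t2_space, second_countable_topology}, 'e::euclidean_space) atlas"
    and A2 :: "('b::{t2_space, second_countable_topology}, 'f::euclidean_space) atlas"
    and P1 :: "'a cotensor" and P2 :: "'b cotensor"
    and g1 :: "'a tmetric" and g2 :: "'b tmetric"
    and q1 q2 k1 k2 :: nat
    and f1 \<nu>1 :: "'a \<Rightarrow> real"
    and dx :: "nat \<Rightarrow> 'a form" and dy :: "nat \<Rightarrow> 'b form"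
    and U1 :: "'a set" and U2 :: "'b set"
    and A :: "('a \<times> 'b, 'e \<times> 'f) atlas"
    and P gt :: "('a \<times> 'b) cotensor"
    and D :: "('a \<times> 'b) form \<Rightarrow> ('a \<times> 'b) form \<Rightarrow> ('a \<times> 'b) form"
    and K :: "('a \<times> 'b) form \<Rightarrow> ('a \<times> 'b) form \<Rightarrow> 'a \<times> 'b \<Rightarrow> real"
    and dxh fdyv :: "nat \<Rightarrow> ('a \<times> 'b) form"
  assumes "k1 = DIM('e)" and "k2 = DIM('f)"
    and "smooth_atlas A1" and "smooth_atlas A2"
    and "poisson A1 P1" and "poisson A2 P2"
    and "semi_riemannian_metric A1 q1 g1" and "semi_riemannian_metric A2 q2 g2"
    and "smooth_fun A1 UNIV f1" and "\<forall>x. 0 < f1 x" and "smooth_fun A1 UNIV \<nu>1"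
    and "open U1" and "orthonormal_coframe A1 (cometric A1 g1) q1 U1 dx"
    and "open U2" and "orthonormal_coframe A2 (cometric A2 g2) q2 U2 dy"
    and "A = prod_atlas A1 A2"
    and "P = warped_bivector A1 A2 P1 \<nu>1 P2"
    and "gt = cometric A (warped_metric A1 A2 g1 f1 g2)"
    and "levi_civita A gt P D"
    and "K = sectional_curvature A gt P D"
    and "dxh = (\<lambda>i. hlift A1 A2 (dx i))"
    and "fdyv = (\<lambda>i. form_mult (f1 \<circ> fst) (vlift A1 A2 (dy i)))"
  shows "(\<forall>i\<in>{1..q1}. \<forall>s\<in>{q1+1..k1}.
            null_pair A gt (U1 \<times> U2) (null_form (dxh i) (dxh s)) (null_form_bar (dxh i) (dxh s))) \<and>
         (\<forall>i\<in>{1..q1}. \<forall>s\<in>{q2+1..k2}.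
            null_pair A gt (U1 \<times> U2) (null_form (dxh i) (fdyv s)) (null_form_bar (dxh i) (fdyv s))) \<and>
         (\<forall>i\<in>{1..q2}. \<forall>s\<in>{q1+1..k1}.
            null_pair A gt (U1 \<times> U2) (null_form (fdyv i) (dxh s)) (null_form_bar (fdyv i) (dxh s))) \<and>
         (\<forall>i\<in>{1..q2}. \<forall>s\<in>{q2+1..k2}.
            null_pair A gt (U1 \<times> U2) (null_form (fdyv i) (fdyv s)) (null_form_bar (fdyv i) (fdyv s))) \<and>
         (\<forall>p\<in>U1 \<times> U2.
            qualar_curvature K q1 k1 q2 k2 dxh fdyv p =
              2 * (\<Sum>i=1..q1. \<Sum>s=q1+1..k1.
                     K (null_form (dxh i) (dxh s)) (null_form_bar (dxh i) (dxh s)) p) +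
              2 * (\<Sum>i=1..q1. \<Sum>s=q2+1..k2.
                     K (null_form (dxh i) (fdyv s)) (null_form_bar (dxh i) (fdyv s)) p) +
              2 * (\<Sum>i=1..q2. \<Sum>s=q1+1..k1.
                     K (null_form (fdyv i) (dxh s)) (null_form_bar (fdyv i) (dxh s)) p) +
              2 * (\<Sum>i=1..q2. \<Sum>s=q2+1..k2.
                     K (null_form (fdyv i) (fdyv s)) (null_form_bar (fdyv i) (fdyv s)) p))"
proof -
  let ?G = "warped_metric A1 A2 g1 f1 g2" and ?W = "U1 \<times> U2"
  note A1 = \<open>smooth_atlas A1\<close> and A2 = \<open>smooth_atlas A2\<close>
  have A: "smooth_atlas A" unfolding \<open>A = prod_atlas A1 A2\<close> by (rule smooth_atlas_prod[OF A1 A2])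
  have g1: "scalar_product_at A1 g1 x" and g2: "scalar_product_at A2 g2 y" for x y
    using semi_riemannian_scalar_product \<open>semi_riemannian_metric A1 q1 g1\<close>
      \<open>semi_riemannian_metric A2 q2 g2\<close> by blast+
  have f1: "f1 x \<noteq> 0" for x using \<open>\<forall>x. 0 < f1 x\<close> by (metis less_irrefl)
  have W: "open ?W" using \<open>open U1\<close> \<open>open U2\<close> by (rule open_Times)
  interpret lc: local_levi_civita A ?G P D ?W
  proof
    show "smooth_atlas A" by (rule A)
    show "scalar_product_at A ?G x" for x
      unfolding \<open>A = prod_atlas A1 A2\<close> by (rule warped_metric_scalar_product[OF A1 A2 g1 g2 f1])
    show "levi_civita A (cometric A ?G) P D"
      using \<open>levi_civita A gt P D\<close> \<open>gt = cometric A ?G\<close> by simp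
  qed (rule W)
  have q: "q1 \<le> k1" "q2 \<le> k2"
    using semi_riemannian_index_le[OF A1 \<open>semi_riemannian_metric A1 q1 g1\<close>]
      semi_riemannian_index_le[OF A2 \<open>semi_riemannian_metric A2 q2 g2\<close>]
      \<open>k1 = DIM('e)\<close> \<open>k2 = DIM('f)\<close> by simp_all
  have dx: "one_form A1 U1 (dx i)" if "i \<in> {1..k1}" for i
    using \<open>orthonormal_coframe A1 (cometric A1 g1) q1 U1 dx\<close> that \<open>k1 = DIM('e)\<close>
    unfolding orthonormal_coframe_def by blast
  have dy: "one_form A2 U2 (dy i)" if "i \<in> {1..k2}" for i
    using \<open>orthonormal_coframe A2 (cometric A2 g2) q2 U2 dy\<close> that \<open>k2 = DIM('f)\<close>
    unfolding orthonormal_coframe_def by blast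
  have ortho_dx: "cometric A1 g1 x (dx i x) (dx j x) = (if i = j then (if i \<le> q1 then - 1 else 1) else 0)"
    if "i \<in> {1..k1}" "j \<in> {1..k1}" "x \<in> U1" for i j x
    using \<open>orthonormal_coframe A1 (cometric A1 g1) q1 U1 dx\<close> that \<open>k1 = DIM('e)\<close>
    unfolding orthonormal_coframe_def by blast
  have ortho_dy: "cometric A2 g2 y (dy i y) (dy j y) = (if i = j then (if i \<le> q2 then - 1 else 1) else 0)"
    if "i \<in> {1..k2}" "j \<in> {1..k2}" "y \<in> U2" for i j y
    using \<open>orthonormal_coframe A2 (cometric A2 g2) q2 U2 dy\<close> that \<open>k2 = DIM('f)\<close>
    unfolding orthonormal_coframe_def by blast
  have forms: "i \<in> {1..k1} \<Longrightarrow> lc.form (dxh i)" "i \<in> {1..k2} \<Longrightarrow> lc.form (fdyv i)" for i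
  proof -
    show "lc.form (dxh i)" if "i \<in> {1..k1}"
      unfolding \<open>dxh = _\<close> \<open>A = prod_atlas A1 A2\<close>
      by (rule one_form_lifts(1)[OF A1 A2 \<open>open U1\<close> \<open>open U2\<close> dx[OF that]])
    have "smooth_fun A ?W (f1 \<circ> fst)"
      unfolding \<open>A = prod_atlas A1 A2\<close> o_def
      by (rule smooth_fun_Times(1)[OF A1 A2 \<open>open U1\<close> \<open>open U2\<close>])
        (rule smooth_fun_subset[OF \<open>smooth_fun A1 UNIV f1\<close> subset_UNIV])
    moreover have "one_form A ?W (vlift A1 A2 (dy i))" if "i \<in> {1..k2}"
      unfolding \<open>A = prod_atlas A1 A2\<close>
      by (rule one_form_lifts(2)[OF A1 A2 \<open>open U1\<close> \<open>open U2\<close> dy[OF that]])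
    ultimately show "lc.form (fdyv i)" if "i \<in> {1..k2}"
      unfolding \<open>fdyv = _\<close> using that by (intro one_form_mult[OF A W])
  qed
  have dx_cot: "dx i (fst x) \<in> cotangent_space A1 (fst x)" if "i \<in> {1..k1}" "x \<in> ?W" for i x
    using one_form_cotangent[OF dx] that by auto
  have dy_cot: "dy i (snd x) \<in> cotangent_space A2 (snd x)" if "i \<in> {1..k2}" "x \<in> ?W" for i x
    using one_form_cotangent[OF dy] that by auto
  note eqs = \<open>dxh = _\<close> \<open>fdyv = _\<close> \<open>gt = cometric A ?G\<close> \<open>A = prod_atlas A1 A2\<close>
  have gram_hh: "gt x (dxh i x) (dxh j x) = (if i = j then (if i \<le> q1 then - 1 else 1) else 0)"
    if "i \<in> {1..k1}" "j \<in> {1..k1}" "x \<in> ?W" for i j x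
    unfolding eqs warped_cometric_horizontal[where f = f1 and x = x and \<alpha> = "dx i" and \<alpha>' = "dx j",
      OF A1 A2 g1 g2 f1 dx_cot[OF that(1,3)] dx_cot[OF that(2,3)]]
    using that by (intro ortho_dx) auto
  have gram_vv: "gt x (fdyv i x) (fdyv j x) = (if i = j then (if i \<le> q2 then - 1 else 1) else 0)"
    if "i \<in> {1..k2}" "j \<in> {1..k2}" "x \<in> ?W" for i j x
    unfolding eqs warped_cometric_vertical[where f = f1 and x = x and \<beta> = "dy i" and \<beta>' = "dy j",
      OF A1 A2 g1 g2 f1 dy_cot[OF that(1,3)] dy_cot[OF that(2,3)]]
    using that by (intro ortho_dy) auto
  have gram_hv: "gt x (dxh i x) (fdyv j x) = 0" "gt x (fdyv j x) (dxh i x) = 0"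
    if "i \<in> {1..k1}" "j \<in> {1..k2}" "x \<in> ?W" for i j x
    unfolding eqs
    by (rule warped_cometric_mixed[where f = f1 and x = x and \<alpha> = "dx i" and \<beta> = "dy j",
      OF A1 A2 g1 g2 f1 dx_cot[OF that(1,3)] dy_cot[OF that(2,3)]])+
  have null: "null_pair A gt ?W (null_form \<tau> \<sigma>) (null_form_bar \<tau> \<sigma>)"
    "p \<in> ?W \<Longrightarrow> K (null_form \<tau> \<sigma>) (null_form_bar \<tau> \<sigma>) p = K \<tau> \<sigma> p"
    if "lc.form \<tau>" "lc.form \<sigma>" "\<And>x. x \<in> ?W \<Longrightarrow> gt x (\<tau> x) (\<tau> x) = - 1"
      "\<And>x. x \<in> ?W \<Longrightarrow> gt x (\<tau> x) (\<sigma> x) = 0" "\<And>x. x \<in> ?W \<Longrightarrow> gt x (\<sigma> x) (\<sigma> x) = 1" for \<tau> \<sigma> p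
    using lc.null_pair_null_forms[OF that[unfolded \<open>gt = cometric A ?G\<close>]]
      lc.sectional_curvature_null_forms[OF that[unfolded \<open>gt = cometric A ?G\<close>]]
    unfolding \<open>K = _\<close> \<open>gt = cometric A ?G\<close> by simp_all
  have hh: "null_pair A gt ?W (null_form (dxh i) (dxh s)) (null_form_bar (dxh i) (dxh s))"
    "p \<in> ?W \<Longrightarrow> K (null_form (dxh i) (dxh s)) (null_form_bar (dxh i) (dxh s)) p = K (dxh i) (dxh s) p"
    if "i \<in> {1..q1}" "s \<in> {q1+1..k1}" for i s p
    using that q by (auto intro!: null forms simp: gram_hh)
  have hv: "null_pair A gt ?W (null_form (dxh i) (fdyv s)) (null_form_bar (dxh i) (fdyv s))"
    "p \<in> ?W \<Longrightarrow> K (null_form (dxh i) (fdyv s)) (null_form_bar (dxh i) (fdyv s)) p = K (dxh i) (fdyv s) p"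
    if "i \<in> {1..q1}" "s \<in> {q2+1..k2}" for i s p
    using that q by (auto intro!: null forms simp: gram_hh gram_vv gram_hv)
  have vh: "null_pair A gt ?W (null_form (fdyv i) (dxh s)) (null_form_bar (fdyv i) (dxh s))"
    "p \<in> ?W \<Longrightarrow> K (null_form (fdyv i) (dxh s)) (null_form_bar (fdyv i) (dxh s)) p = K (fdyv i) (dxh s) p"
    if "i \<in> {1..q2}" "s \<in> {q1+1..k1}" for i s p
    using that q by (auto intro!: null forms simp: gram_hh gram_vv gram_hv)
  have vv: "null_pair A gt ?W (null_form (fdyv i) (fdyv s)) (null_form_bar (fdyv i) (fdyv s))"
    "p \<in> ?W \<Longrightarrow> K (null_form (fdyv i) (fdyv s)) (null_form_bar (fdyv i) (fdyv s)) p = K (fdyv i) (fdyv s) p"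
    if "i \<in> {1..q2}" "s \<in> {q2+1..k2}" for i s p
    using that q by (auto intro!: null forms simp: gram_vv)
  show ?thesis
  proof (intro conjI ballI)
    fix p assume p: "p \<in> ?W"
    show "qualar_curvature K q1 k1 q2 k2 dxh fdyv p =
        2 * (\<Sum>i=1..q1. \<Sum>s=q1+1..k1. K (null_form (dxh i) (dxh s)) (null_form_bar (dxh i) (dxh s)) p) +
        2 * (\<Sum>i=1..q1. \<Sum>s=q2+1..k2. K (null_form (dxh i) (fdyv s)) (null_form_bar (dxh i) (fdyv s)) p) +
        2 * (\<Sum>i=1..q2. \<Sum>s=q1+1..k1. K (null_form (fdyv i) (dxh s)) (null_form_bar (fdyv i) (dxh s)) p) +
        2 * (\<Sum>i=1..q2. \<Sum>s=q2+1..k2. K (null_form (fdyv i) (fdyv s)) (null_form_bar (fdyv i) (fdyv s)) p)"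
      unfolding qualar_curvature_def
      by (intro arg_cong2[where f = "(+)"] arg_cong[where f = "(*) 2"] sum.cong refl
          hh(2)[OF _ _ p, symmetric] hv(2)[OF _ _ p, symmetric]
          vh(2)[OF _ _ p, symmetric] vv(2)[OF _ _ p, symmetric])
  qed (fact hh(1) hv(1) vh(1) vv(1))+
qed

end
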